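(* There are exactly three open orbits for the action of $G_0=SO(\infty,2)$ on $\mathcal Z$: the two $h$-negative definite orbits $D_0=G_0([e_1+\sqrt{-1}\,e_2])$ and $D_1=G_0([e_1-\sqrt{-1}\,e_2])$, and the $h$-positive definite orbit $D_2=G_0([e_{-1}+\sqrt{-1}\,e_{-2}])$.
   Context: $V$ is the complex vector space with countable basis $E=\{\dots,e_{-3},e_{-2},e_{-1},e_1,e_2\}$, hermitian form $h(e_i,e_j)=\delta_{i,j}$ for $i<0$, $h(e_i,e_j)=-\delta_{i,j}$ for $i>0$, and symmetric bilinear form $b(e_i,e_j)=\delta_{i,j}$ for all $i,j$. $G=SO(\infty;\mathbb C)$ is the group of linear transformations of $V$ of determinant $1$ preserving $b$ and fixing all but finitely many elements of $E$; $G_0=SO(\infty,2)$ is the topological identity component (direct limit topology) of the subgroup of $G$ preserving $h$. $\mathcal Z=\{[v]\in\mathcal P(V)\mid b(v,v)=0\}$ is the nondegenerate complex quadric in the projective space $\mathcal P(V)$, with the direct limit topology from the quadrics $\mathcal Z_n=\mathcal Z\cap\mathcal P(V_n)$, $V_n=\mathrm{Span}\{e_{-n},\dots,e_{-1},e_1,e_2\}$. An orbit is $h$-negative (positive) definite if $h$ is negative (positive) definite on the lines it consists of. *)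

theory Defs
  imports "HOL-Analysis.Analysis" "HOL-Algebra.Group_Action" "HOL-Library.Poly_Mapping"
begin

section \<open>The space \<open>V\<close> and its two forms\<close>

typedef idx = "{i::int. i < 0 \<or> i = 1 \<or> i = 2}"
  by (rule exI[of _ 1]) simp

type_synonym V = "idx \<Rightarrow>\<^sub>0 complex"

definition scale :: "complex \<Rightarrow> V \<Rightarrow> V"
  where "scale c v = Poly_Mapping.map (\<lambda>z. c * z) v"

lemma lookup_scale [simp]:
  "Poly_Mapping.lookup (scale c v) i = c * Poly_Mapping.lookup v i"
  by (simp add: scale_def Poly_Mapping.map.rep_eq when_def)

interpretation V: vector_space scale
  by standard (rule poly_mapping_eqI, simp add: lookup_add algebra_simps)+

definition evec :: "idx \<Rightarrow> V"
  where "evec i = Poly_Mapping.single i 1"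

definition bform :: "V \<Rightarrow> V \<Rightarrow> complex"
  where "bform x y = (\<Sum>i\<in>Poly_Mapping.keys x. Poly_Mapping.lookup x i * Poly_Mapping.lookup y i)"

text \<open>The Hermitian form is linear in its first and conjugate-linear in its second argument.\<close>

definition hform :: "V \<Rightarrow> V \<Rightarrow> complex"
  where "hform x y = (\<Sum>i\<in>Poly_Mapping.keys x. (if Rep_idx i < 0 then 1 else -1) *
    Poly_Mapping.lookup x i * cnj (Poly_Mapping.lookup y i))"

lemma bform_evec: "bform (evec i) (evec j) = (if i = j then 1 else 0)"
  by (simp add: bform_def evec_def lookup_single when_def)

lemma hform_evec: "hform (evec i) (evec j) = (if i = j then (if Rep_idx i < 0 then 1 else -1) else 0)"
  by (simp add: hform_def evec_def lookup_single when_def)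

lemma bform_superset:
  assumes "finite S" "Poly_Mapping.keys x \<subseteq> S"
  shows "bform x y = (\<Sum>i\<in>S. Poly_Mapping.lookup x i * Poly_Mapping.lookup y i)"
  unfolding bform_def using assms by (intro sum.mono_neutral_left) (auto simp: in_keys_iff)

lemma hform_superset:
  assumes "finite S" "Poly_Mapping.keys x \<subseteq> S"
  shows "hform x y = (\<Sum>i\<in>S. (if Rep_idx i < 0 then 1 else -1) *
    Poly_Mapping.lookup x i * cnj (Poly_Mapping.lookup y i))"
  unfolding hform_def using assms by (intro sum.mono_neutral_left) (auto simp: in_keys_iff)

lemma keys_scale: "Poly_Mapping.keys (scale c x) \<subseteq> Poly_Mapping.keys x"
  by (auto simp: in_keys_iff)

lemma bform_add_left: "bform (x + x') y = bform x y + bform x' y"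
proof -
  let ?S = "Poly_Mapping.keys x \<union> Poly_Mapping.keys x'"
  show ?thesis
    using keys_add[of x x']
    by (simp add: bform_superset[of ?S] lookup_add algebra_simps sum.distrib)
qed

lemma bform_scale_left: "bform (scale c x) y = c * bform x y"
  using bform_superset[OF _ keys_scale] by (simp add: bform_def sum_distrib_left mult.assoc)

lemma bform_sym: "bform x y = bform y x"
proof -
  let ?S = "Poly_Mapping.keys x \<union> Poly_Mapping.keys y"
  show ?thesis by (simp add: bform_superset[of ?S x] bform_superset[of ?S y] mult.commute)
qed

lemma hform_add_left: "hform (x + x') y = hform x y + hform x' y"
proof -
  let ?S = "Poly_Mapping.keys x \<union> Poly_Mapping.keys x'"
  show ?thesis
    using keys_add[of x x']
    by (simp add: hform_superset[of ?S] lookup_add algebra_simps sum.distrib)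
qed

lemma hform_scale_left: "hform (scale c x) y = c * hform x y"
  using hform_superset[OF _ keys_scale] by (simp add: hform_def sum_distrib_left algebra_simps)

lemma hform_cnj: "hform x y = cnj (hform y x)"
proof -
  let ?S = "Poly_Mapping.keys x \<union> Poly_Mapping.keys y"
  have "hform x y = (\<Sum>i\<in>?S. (if Rep_idx i < 0 then 1 else -1) *
      Poly_Mapping.lookup x i * cnj (Poly_Mapping.lookup y i))"
    by (rule hform_superset) auto
  also have "\<dots> = cnj (\<Sum>i\<in>?S. (if Rep_idx i < 0 then 1 else -1) *
      Poly_Mapping.lookup y i * cnj (Poly_Mapping.lookup x i))"
    unfolding cnj_sum by (rule sum.cong) auto
  also have "\<dots> = cnj (hform y x)"
    by (subst hform_superset[of ?S y]) auto
  finally show ?thesis .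
qed

lemma hform_self_real: "hform x x \<in> \<real>"
  using hform_cnj[of x x] by (simp add: Reals_cnj_iff)

text \<open>\<open>V_n n\<close> is the space with basis \<open>e_{-n}, \<dots>, e_{-1}, e_1, e_2\<close>.\<close>

definition V_n :: "nat \<Rightarrow> V set"
  where "V_n n = V.span (evec ` {i. - int n \<le> Rep_idx i})"

lemma ex_V_n: "\<exists>n. v \<in> V_n n"
proof -
  obtain m where m: "\<And>i. i \<in> Poly_Mapping.keys v \<Longrightarrow> nat (- Rep_idx i) \<le> m"
    using finite_nat_set_iff_bounded_le[of "(\<lambda>i. nat (- Rep_idx i)) ` Poly_Mapping.keys v"]
    by auto
  have "v = (\<Sum>i\<in>Poly_Mapping.keys v. scale (Poly_Mapping.lookup v i) (evec i))"
    by (rule poly_mapping_eqI)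
      (simp add: lookup_sum evec_def lookup_single when_def if_distrib in_keys_iff cong: if_cong)
  also have "\<dots> \<in> V_n m"
    unfolding V_n_def using m by (intro V.span_sum V.span_scale V.span_base) force
  finally show ?thesis by blast
qed

section \<open>Topological constructions\<close>

text \<open>The direct limit of an ascending sequence of spaces: a set is open iff its trace on every
  member of the sequence is open.\<close>

definition direct_limit_topology :: "(nat \<Rightarrow> 'a topology) \<Rightarrow> 'a topology"
  where "direct_limit_topology X = topology (\<lambda>U. U \<subseteq> (\<Union>n. topspace (X n)) \<and>
    (\<forall>n. openin (X n) (U \<inter> topspace (X n))))"

lemma openin_direct_limit_topology:
  "openin (direct_limit_topology X) U \<longleftrightarrow> U \<subseteq> (\<Union>n. topspace (X n)) \<and>
    (\<forall>n. openin (X n) (U \<inter> topspace (X n)))"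
proof -
  have "istopology (\<lambda>U. U \<subseteq> (\<Union>n. topspace (X n)) \<and>
    (\<forall>n. openin (X n) (U \<inter> topspace (X n))))"
    unfolding istopology_def
  proof (intro conjI allI impI; (elim conjE)?)
    fix S T n
    assume "\<forall>n. openin (X n) (S \<inter> topspace (X n))" "\<forall>n. openin (X n) (T \<inter> topspace (X n))"
    then have "openin (X n) ((S \<inter> topspace (X n)) \<inter> (T \<inter> topspace (X n)))"
      by blast
    then show "openin (X n) (S \<inter> T \<inter> topspace (X n))"
      by (simp add: Int_ac)
  next
    fix K n
    assume "\<forall>S\<in>K. S \<subseteq> (\<Union>n. topspace (X n)) \<and> (\<forall>n. openin (X n) (S \<inter> topspace (X n)))"
    then have "openin (X n) (\<Union>S\<in>K. S \<inter> topspace (X n))"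
      by blast
    then show "openin (X n) (\<Union>K \<inter> topspace (X n))"
      by (simp only: Int_Union2)
  qed blast+
  then show ?thesis
    by (simp add: direct_limit_topology_def)
qed

lemma topspace_direct_limit_topology:
  "topspace (direct_limit_topology X) = (\<Union>n. topspace (X n))"
proof (rule antisym)
  show "topspace (direct_limit_topology X) \<subseteq> (\<Union>n. topspace (X n))"
    using openin_topspace[of "direct_limit_topology X"]
    unfolding openin_direct_limit_topology by blast
  have "(\<Union>n. topspace (X n)) \<inter> topspace (X m) = topspace (X m)" for m
    by blast
  then have "openin (direct_limit_topology X) (\<Union>n. topspace (X n))"
    unfolding openin_direct_limit_topology by simp
  then show "(\<Union>n. topspace (X n)) \<subseteq> topspace (direct_limit_topology X)"
    by (rule openin_subset)
qed

definition quotient_topology :: "'a topology \<Rightarrow> ('a \<Rightarrow> 'b) \<Rightarrow> 'b topology"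
  where "quotient_topology X f = topology (\<lambda>U. U \<subseteq> f ` topspace X \<and>
    openin X {x \<in> topspace X. f x \<in> U})"

lemma openin_quotient_topology:
  "openin (quotient_topology X f) U \<longleftrightarrow>
    U \<subseteq> f ` topspace X \<and> openin X {x \<in> topspace X. f x \<in> U}"
proof -
  have "istopology (\<lambda>U. U \<subseteq> f ` topspace X \<and> openin X {x \<in> topspace X. f x \<in> U})"
    unfolding istopology_def
  proof (intro conjI allI impI; (elim conjE)?)
    fix S T
    assume "openin X {x \<in> topspace X. f x \<in> S}" "openin X {x \<in> topspace X. f x \<in> T}"
    then have "openin X ({x \<in> topspace X. f x \<in> S} \<inter> {x \<in> topspace X. f x \<in> T})"
      by blast
    also have "\<dots> = {x \<in> topspace X. f x \<in> S \<inter> T}"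
      by blast
    finally show "openin X {x \<in> topspace X. f x \<in> S \<inter> T}" .
  next
    fix K
    assume "\<forall>S\<in>K. S \<subseteq> f ` topspace X \<and> openin X {x \<in> topspace X. f x \<in> S}"
    then have "openin X (\<Union>S\<in>K. {x \<in> topspace X. f x \<in> S})"
      by blast
    also have "(\<Union>S\<in>K. {x \<in> topspace X. f x \<in> S}) = {x \<in> topspace X. f x \<in> \<Union>K}"
      by blast
    finally show "openin X {x \<in> topspace X. f x \<in> \<Union>K}" .
  qed blast+
  then show ?thesis
    by (simp add: quotient_topology_def)
qed

lemma topspace_quotient_topology: "topspace (quotient_topology X f) = f ` topspace X"
proof (rule antisym)
  show "topspace (quotient_topology X f) \<subseteq> f ` topspace X"
    using openin_topspace[of "quotient_topology X f"]
    by (simp only: openin_quotient_topology)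
  have "{x \<in> topspace X. f x \<in> f ` topspace X} = topspace X"
    by blast
  then have "openin (quotient_topology X f) (f ` topspace X)"
    by (simp add: openin_quotient_topology)
  then show "f ` topspace X \<subseteq> topspace (quotient_topology X f)"
    by (rule openin_subset)
qed

lemma quotient_map_quotient_topology: "quotient_map X (quotient_topology X f) f"
  by (simp add: quotient_map_def openin_quotient_topology topspace_quotient_topology)

section \<open>The groups \<open>SO(\<infinity>;\<complex>)\<close> and \<open>SO(\<infinity>,2)\<close>\<close>

definition moved :: "(V \<Rightarrow> V) \<Rightarrow> idx set"
  where "moved g = {i. g (evec i) \<noteq> evec i}"

definition leibniz :: "idx set \<Rightarrow> (V \<Rightarrow> V) \<Rightarrow> complex"
  where "leibniz F g = (\<Sum>p | p permutes F. of_int (sign p) *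
    (\<Prod>i\<in>F. Poly_Mapping.lookup (g (evec i)) (p i)))"

text \<open>If \<open>g\<close> is linear and fixes almost all basis vectors, its matrix is block triangular with
  an identity block off \<open>moved g\<close>; its determinant is the one of the remaining finite block.
  Any larger finite block gives the same value, see \<open>leibniz_superset\<close>.\<close>

definition fdet :: "(V \<Rightarrow> V) \<Rightarrow> complex"
  where "fdet g = leibniz (moved g) g"

lemma leibniz_superset:
  assumes "finite F" "moved g \<subseteq> F"
  shows "leibniz F g = fdet g"
proof -
  let ?M = "moved g"
  let ?t = "\<lambda>S p. of_int (sign p) * (\<Prod>i\<in>S. Poly_Mapping.lookup (g (evec i)) (p i)) :: complex"
  have off: "Poly_Mapping.lookup (g (evec i)) k = (if k = i then 1 else 0)" if "i \<notin> ?M" for i k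
    using that by (auto simp: moved_def evec_def lookup_single when_def)
  have zero: "?t F p = 0" if p: "p permutes F" and np: "\<not> p permutes ?M" for p
  proof -
    have "\<exists>i\<in>F - ?M. p i \<noteq> i"
    proof (rule ccontr)
      assume "\<not> (\<exists>i\<in>F - ?M. p i \<noteq> i)"
      then have "p permutes ?M"
        using p by (intro permutes_superset[OF p]) auto
      then show False using np by simp
    qed
    then obtain i where "i \<in> F" "i \<notin> ?M" "p i \<noteq> i" by blast
    then have "(\<Prod>i\<in>F. Poly_Mapping.lookup (g (evec i)) (p i)) = 0"
      using assms(1) off[of i "p i"] by (intro prod_zero) auto
    then show ?thesis by simp
  qed
  have same: "?t F p = ?t ?M p" if p: "p permutes ?M" for p
  proof -
    have "(\<Prod>i\<in>?M. Poly_Mapping.lookup (g (evec i)) (p i)) =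
        (\<Prod>i\<in>F. Poly_Mapping.lookup (g (evec i)) (p i))"
      using assms off p by (intro prod.mono_neutral_left) (auto simp: permutes_not_in)
    then show ?thesis by simp
  qed
  have "leibniz F g = (\<Sum>p | p permutes ?M. ?t F p)"
    unfolding leibniz_def
    using assms zero by (intro sum.mono_neutral_right finite_permutations)
      (auto intro: permutes_subset)
  also have "\<dots> = fdet g"
    unfolding fdet_def leibniz_def using same by (intro sum.cong) auto
  finally show ?thesis .
qed

definition SO_inf :: "(V \<Rightarrow> V) set"
  where "SO_inf = {g. Vector_Spaces.linear scale scale g \<and> finite (moved g) \<and> fdet g = 1 \<and>
    (\<forall>x y. bform (g x) (g y) = bform x y)}"

text \<open>The subgroup \<open>SO(V_n n)\<close>. Since its elements preserve \<open>bform\<close> and fix the other basis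
  vectors, they map \<open>V_n n\<close> to itself.\<close>

definition SO_n :: "nat \<Rightarrow> (V \<Rightarrow> V) set"
  where "SO_n n = {g \<in> SO_inf. \<forall>i. Rep_idx i < - int n \<longrightarrow> g (evec i) = evec i}"

text \<open>Only the finitely many matrix entries with both indices \<open>\<ge> -n\<close> vary on \<open>SO_n n\<close>, so
  pulling back the product topology on all matrices gives the usual topology of a matrix group.\<close>

definition SO_n_top :: "nat \<Rightarrow> (V \<Rightarrow> V) topology"
  where "SO_n_top n = pullback_topology (SO_n n)
    (\<lambda>g i j. Poly_Mapping.lookup (g (evec j)) i) (euclidean :: (idx \<Rightarrow> idx \<Rightarrow> complex) topology)"

definition SO_inf_top :: "(V \<Rightarrow> V) topology"
  where "SO_inf_top = direct_limit_topology SO_n_top"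

lemma topspace_SO_n_top: "topspace (SO_n_top n) = SO_n n"
  by (simp add: SO_n_top_def topspace_pullback_topology)

lemma topspace_SO_inf_top: "topspace SO_inf_top = SO_inf"
proof -
  have "\<exists>n. g \<in> SO_n n" if g: "g \<in> SO_inf" for g
  proof -
    have "finite (moved g)"
      using g by (simp add: SO_inf_def)
    then obtain m where m: "\<And>i. i \<in> moved g \<Longrightarrow> nat (- Rep_idx i) \<le> m"
      using finite_nat_set_iff_bounded_le[of "(\<lambda>i. nat (- Rep_idx i)) ` moved g"] by auto
    have "g \<in> SO_n m"
      using g m by (force simp: SO_n_def moved_def)
    then show ?thesis ..
  qed
  then show ?thesis
    by (auto simp: SO_inf_top_def topspace_direct_limit_topology topspace_SO_n_top SO_n_def)
qed

definition SO_inf_h :: "(V \<Rightarrow> V) set"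
  where "SO_inf_h = {g \<in> SO_inf. \<forall>x y. hform (g x) (g y) = hform x y}"

text \<open>The identity component of the subgroup preserving \<open>hform\<close>, which carries the topology
  induced by the direct limit topology of \<open>SO_inf\<close>. That subgroup is closed, so the direct
  limit of its intersections with the groups \<open>SO_n n\<close> is the same topology.\<close>

definition G0 :: "(V \<Rightarrow> V) monoid"
  where "G0 = \<lparr>carrier = connected_component_of_set (subtopology SO_inf_top SO_inf_h) id,
    mult = (\<circ>), one = id\<rparr>"

section \<open>The quadric\<close>

text \<open>Points of the projective space are lines, that is, one-dimensional subspaces of \<open>V\<close>.\<close>

definition pt :: "V \<Rightarrow> V set"
  where "pt v = V.span {v}"

text \<open>\<open>\<P>(V_n n)\<close> with the quotient topology. On \<open>V_n n\<close> only finitely many coordinates are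
  not identically zero, so the pullback of the product topology is the Euclidean one.\<close>

definition V_n_top :: "nat \<Rightarrow> V topology"
  where "V_n_top n = pullback_topology (V_n n) Poly_Mapping.lookup
    (euclidean :: (idx \<Rightarrow> complex) topology)"

definition P_n_top :: "nat \<Rightarrow> V set topology"
  where "P_n_top n = quotient_topology (subtopology (V_n_top n) (- {0})) pt"

definition Z :: "V set set"
  where "Z = {pt v | v. v \<noteq> 0 \<and> bform v v = 0}"

definition Z_top :: "V set topology"
  where "Z_top = direct_limit_topology (\<lambda>n. subtopology (P_n_top n) Z)"

lemma topspace_Z_top: "topspace Z_top = Z"
proof -
  have "topspace (P_n_top n) = pt ` (V_n n - {0})" for n
    by (simp add: P_n_top_def topspace_quotient_topology V_n_top_def topspace_pullback_topology
        Diff_eq)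
  then show ?thesis
    using ex_V_n by (fastforce simp: Z_top_def topspace_direct_limit_topology Z_def)
qed

definition act :: "(V \<Rightarrow> V) \<Rightarrow> V set \<Rightarrow> V set"
  where "act g L = g ` L"

lemma act_pt:
  assumes "Vector_Spaces.linear scale scale g"
  shows "act g (pt v) = pt (g v)"
proof -
  interpret g: Vector_Spaces.linear scale scale g by fact
  show ?thesis by (simp add: act_def pt_def g.span_image[symmetric])
qed

text \<open>The values \<open>hform v v\<close> are real by \<open>hform_self_real\<close>.\<close>

definition h_negative_definite :: "V set set \<Rightarrow> bool"
  where "h_negative_definite D \<longleftrightarrow> (\<forall>L\<in>D. \<forall>v\<in>L. v \<noteq> 0 \<longrightarrow> Re (hform v v) < 0)"

definition h_positive_definite :: "V set set \<Rightarrow> bool"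
  where "h_positive_definite D \<longleftrightarrow> (\<forall>L\<in>D. \<forall>v\<in>L. v \<noteq> 0 \<longrightarrow> Re (hform v v) > 0)"

definition D0 :: "V set set"
  where "D0 = orbit G0 act (pt (evec (Abs_idx 1) + scale \<i> (evec (Abs_idx 2))))"

definition D1 :: "V set set"
  where "D1 = orbit G0 act (pt (evec (Abs_idx 1) - scale \<i> (evec (Abs_idx 2))))"

definition D2 :: "V set set"
  where "D2 = orbit G0 act (pt (evec (Abs_idx (-1)) + scale \<i> (evec (Abs_idx (-2)))))"

end

theory Submission
  imports Defs "Jordan_Normal_Form.Determinant"
begin

text \<open>
  Let \<open>\<sigma>\<close> be the antilinear involution with \<open>h(x, y) = b(x, \<sigma> y)\<close>. Complex rotations in a
  \<open>b\<close>-orthonormal plane, with angle real or imaginary according to the position of the axes relative to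
  \<open>\<sigma>\<close>, are joined to the identity by varying the angle, so \<open>G\<^sub>0\<close> is stable under composition with them.
  Two isotropic vectors with \<open>h > 0\<close> can both be rotated into \<open>e\<^sub>a + \<i>e\<^sub>b\<close> for some \<open>a, b < 0\<close> outside their
  supports. If \<open>h(v, v) < 0\<close>, a phase, a rotation of \<open>e\<^sub>1, e\<^sub>2\<close> and two commuting boosts bring \<open>v\<close> to a multiple of
  \<open>e\<^sub>1 \<plusminus> \<i>e\<^sub>2\<close>, where the sign is that of \<open>|v\<^sub>1 - \<i>v\<^sub>2| - |v\<^sub>1 + \<i>v\<^sub>2|\<close>. This quantity does not vanish on isotropic vectors
  with \<open>h < 0\<close>, so its sign is constant on \<open>G\<^sub>0\<close>-orbits by connectedness and separates the two negative
  orbits. An orbit on which \<open>h\<close> vanishes is not open, since a small multiple of an isotropic vector with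
  disjoint support can be added.
\<close>

abbreviation coord :: "V \<Rightarrow> idx \<Rightarrow> complex"
  where "coord \<equiv> Poly_Mapping.lookup"

section \<open>Multiplicativity of the determinant\<close>

text \<open>Numbering the block \<open>F\<close> by \<open>f\<close> carries permutations of
  \<open>F\<close> to permutations of \<open>{0..<n}\<close> of the same sign, which makes the
  product formula for matrix determinants available.\<close>

lemma leibniz_eq_det:
  assumes f: "bij_betw f {0..<n} F"
  shows "leibniz F g = Determinant.det (mat n n (\<lambda>(i, j). coord (g (evec (f i))) (f j)))"
proof -
  have inj: "inj_on f {0..<n}" and im: "f ` {0..<n} = F"
    using f by (auto simp: bij_betw_def)
  have "leibniz F g = (\<Sum>p | p permutes {0..<n}.
      of_int (sign p) * (\<Prod>i\<in>{0..<n}. coord (g (evec (f i))) (f (p i))))"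
    unfolding leibniz_def
  proof (rule sum.reindex_bij_witness[symmetric,
      of _ "map_permutation F (inv_into {0..<n} f)" "map_permutation {0..<n} f"])
    fix p assume "p \<in> {p. p permutes {0..<n}}"
    then have p: "p permutes {0..<n}" by simp
    show "map_permutation F (inv_into {0..<n} f) (map_permutation {0..<n} f p) = p"
      using f p inj by (intro map_permutation_compose_inv) auto
    show "map_permutation {0..<n} f p \<in> {p. p permutes F}"
      using map_permutation_permutes[OF f p] by simp
    have "(\<Prod>i\<in>F. coord (g (evec i)) (map_permutation {0..<n} f p i)) =
        (\<Prod>i\<in>{0..<n}. coord (g (evec (f i))) (f (p i)))"
      unfolding im[symmetric] using inj by (simp add: prod.reindex map_permutation_apply)
    then show "of_int (sign (map_permutation {0..<n} f p)) *
        (\<Prod>i\<in>F. coord (g (evec i)) (map_permutation {0..<n} f p i)) =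
        of_int (sign p) * (\<Prod>i\<in>{0..<n}. coord (g (evec (f i))) (f (p i)))"
      using sign_map_permutation[OF inj p] by simp
  next
    fix p assume "p \<in> {p. p permutes F}"
    then have p: "p permutes F" by simp
    show "map_permutation {0..<n} f (map_permutation F (inv_into {0..<n} f) p) = p"
      using p im by (intro map_permutation_compose_inv bij_betw_inv_into f) (auto simp: f_inv_into_f)
    show "map_permutation F (inv_into {0..<n} f) p \<in> {p. p permutes {0..<n}}"
      using map_permutation_permutes[OF bij_betw_inv_into[OF f] p] by simp
  qed
  also have "\<dots> = Determinant.det (mat n n (\<lambda>(i, j). coord (g (evec (f i))) (f j)))"
    unfolding Determinant.det_def by (auto intro!: sum.cong prod.cong simp: permutes_in_image)
  finally show ?thesis .
qed

lemma keys_expand: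
  assumes "finite S" "Poly_Mapping.keys v \<subseteq> S"
  shows "v = (\<Sum>i\<in>S. scale (coord v i) (evec i))"
  using assms by (intro poly_mapping_eqI)
    (auto simp: lookup_sum evec_def lookup_single when_def if_distrib in_keys_iff cong: if_cong)

lemma lookup_linear:
  assumes "Vector_Spaces.linear scale scale g" "finite S" "Poly_Mapping.keys v \<subseteq> S"
  shows "coord (g v) j =
    (\<Sum>i\<in>S. coord v i * coord (g (evec i)) j)"
proof -
  interpret g: Vector_Spaces.linear scale scale g by fact
  have "g v = (\<Sum>i\<in>S. scale (coord v i) (g (evec i)))"
    by (subst keys_expand[OF assms(2,3)]) (simp add: g.sum g.scale)
  then show ?thesis by (simp add: lookup_sum)
qed

lemma moved_comp: "moved (g \<circ> k) \<subseteq> moved g \<union> moved k"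
  by (auto simp: moved_def)

lemma fdet_comp:
  assumes g: "Vector_Spaces.linear scale scale g" and "finite (moved g)" "finite (moved k)"
  shows "fdet (g \<circ> k) = fdet g * fdet k"
proof -
  define F where "F = moved g \<union> moved k"
  have F: "finite F" using assms by (simp add: F_def)
  obtain f where f: "bij_betw f {0..<card F} F"
    using ex_bij_betw_nat_finite[OF F] by blast
  let ?n = "card F"
  let ?M = "\<lambda>g. mat ?n ?n (\<lambda>(i, j). coord (g (evec (f i))) (f j))"
  \<comment> \<open>The images of basis vectors are the rows, so composition becomes the matrix
    product in reverse order.\<close>
  have "?M (g \<circ> k) = ?M k * ?M g"
  proof (rule eq_matI)
    fix i j assume "i < dim_row (?M k * ?M g)" "j < dim_col (?M k * ?M g)"
    then have ij: "i < ?n" "j < ?n" by auto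
    have fj: "f j \<in> F" using f ij by (auto simp: bij_betw_def)
    let ?S = "F \<union> Poly_Mapping.keys (k (evec (f i)))"
    have "coord (g (k (evec (f i)))) (f j) =
        (\<Sum>l\<in>?S. coord (k (evec (f i))) l * coord (g (evec l)) (f j))"
      using F by (intro lookup_linear g) auto
    \<comment> \<open>For \<open>l\<close> outside \<open>F\<close> the map \<open>g\<close> fixes
      \<open>evec l\<close>, whose coordinate at \<open>f j\<close> in \<open>F\<close>
      vanishes.\<close>
    also have "\<dots> = (\<Sum>l\<in>F. coord (k (evec (f i))) l * coord (g (evec l)) (f j))"
      using F fj by (intro sum.mono_neutral_right)
        (auto simp: F_def moved_def evec_def lookup_single when_def)
    also have "\<dots> = (\<Sum>l\<in>{0..<?n}. coord (k (evec (f i))) (f l) *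
        coord (g (evec (f l))) (f j))"
      by (rule sum.reindex_bij_betw[OF f, symmetric])
    finally show "?M (g \<circ> k) $$ (i, j) = (?M k * ?M g) $$ (i, j)"
      using ij by (simp add: scalar_prod_def)
  qed auto
  then have "leibniz F (g \<circ> k) = leibniz F k * leibniz F g"
    unfolding leibniz_eq_det[OF f] by (simp add: Determinant.det_mult[of _ ?n])
  then show ?thesis
    using moved_comp[of g k] F by (subst (asm) (1 2 3) leibniz_superset) (auto simp: F_def)
qed

lemma bform_evec_right: "bform v (evec j) = coord v j"
  by (simp add: bform_def evec_def lookup_single when_def if_distrib in_keys_iff cong: if_cong)

text \<open>The finite block of an isometry is an orthogonal matrix.\<close>

lemma fdet_square:
  assumes fin: "finite (moved g)" and b: "\<And>x y. bform (g x) (g y) = bform x y"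
  shows "fdet g * fdet g = 1"
proof -
  obtain f where f: "bij_betw f {0..<card (moved g)} (moved g)"
    using ex_bij_betw_nat_finite[OF fin] by blast
  let ?n = "card (moved g)"
  let ?M = "mat ?n ?n (\<lambda>(i, j). coord (g (evec (f i))) (f j))"
  have "?M * transpose_mat ?M = 1\<^sub>m ?n"
  proof (rule eq_matI)
    fix i j assume "i < dim_row (1\<^sub>m ?n)" "j < dim_col (1\<^sub>m ?n)"
    then have ij: "i < ?n" "j < ?n" by auto
    have mem: "f i \<in> moved g" "f j \<in> moved g" and inj: "f i = f j \<longleftrightarrow> i = j"
      using f ij by (auto simp: bij_betw_def inj_on_def)
    \<comment> \<open>Pairing with a fixed vector \<open>evec l\<close> reads off the coordinate at
      \<open>l\<close>, so the rows have no entries outside the block.\<close>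
    have off: "coord (g (evec (f i))) l = 0" if "l \<notin> moved g" for l
    proof -
      have "coord (g (evec (f i))) l = bform (g (evec (f i))) (g (evec l))"
        using that by (simp add: moved_def bform_evec_right)
      also have "\<dots> = 0"
        using that mem by (auto simp: b bform_evec)
      finally show ?thesis .
    qed
    have "(if i = j then 1 else 0) = bform (g (evec (f i))) (g (evec (f j)))"
      using inj by (simp add: b bform_evec)
    also have "\<dots> = (\<Sum>l\<in>moved g. coord (g (evec (f i))) l * coord (g (evec (f j))) l)"
      using fin off by (intro bform_superset) (auto simp: in_keys_iff)
    also have "\<dots> = (\<Sum>l\<in>{0..<?n}. coord (g (evec (f i))) (f l) *
        coord (g (evec (f j))) (f l))"
      by (rule sum.reindex_bij_betw[OF f, symmetric])
    finally show "(?M * transpose_mat ?M) $$ (i, j) = 1\<^sub>m ?n $$ (i, j)"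
      using ij by (simp add: scalar_prod_def)
  qed auto
  then have "Determinant.det ?M * Determinant.det (transpose_mat ?M) = 1"
    by (subst Determinant.det_mult[of _ ?n, symmetric]) auto
  then show ?thesis
    by (simp add: fdet_def leibniz_eq_det[OF f] Determinant.det_transpose[of _ ?n])
qed

section \<open>Complex rotations\<close>

text \<open>The antilinear involution whose fixed points form the real span of \<open>e\<^sub>i\<close> (\<open>i < 0\<close>),
  \<open>\<i>e\<^sub>1\<close>, \<open>\<i>e\<^sub>2\<close>, on which \<^term>\<open>bform\<close> has signature \<open>(\<infinity>, 2)\<close>. An isometry of \<^term>\<open>bform\<close>
  commuting with it preserves \<^term>\<open>hform\<close>.\<close>

definition sig :: "V \<Rightarrow> V"
  where "sig v = Poly_Mapping.mapp (\<lambda>i c. (if Rep_idx i < 0 then 1 else -1) * cnj c) v"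

lemma lookup_sig: "coord (sig v) i = (if Rep_idx i < 0 then 1 else -1) * cnj (coord v i)"
  by (simp add: sig_def mapp.rep_eq when_def in_keys_iff)

lemma sig_add: "sig (x + y) = sig x + sig y"
  by (rule poly_mapping_eqI) (simp add: lookup_sig lookup_add)

lemma sig_scale: "sig (scale c x) = scale (cnj c) (sig x)"
  by (rule poly_mapping_eqI) (simp add: lookup_sig)

lemma sig_minus: "sig (- x) = - sig x"
  by (rule poly_mapping_eqI) (simp add: lookup_sig)

lemma sig_diff: "sig (x - y) = sig x - sig y"
  by (rule poly_mapping_eqI) (simp add: lookup_sig lookup_minus algebra_simps)

lemma sig_sig: "sig (sig x) = x"
  by (rule poly_mapping_eqI) (simp add: lookup_sig)

lemma keys_sig: "Poly_Mapping.keys (sig x) = Poly_Mapping.keys x"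
  by (auto simp: in_keys_iff lookup_sig)

lemma bform_add_right: "bform x (y + z) = bform x y + bform x z"
  by (metis bform_add_left bform_sym)

lemma bform_scale_right: "bform x (scale c y) = c * bform x y"
  by (metis bform_scale_left bform_sym)

lemma bform_minus_left: "bform (- x) y = - bform x y"
  using bform_scale_left[of "-1" x y] by simp

lemma bform_minus_right: "bform x (- y) = - bform x y"
  by (metis bform_minus_left bform_sym)

lemma bform_diff_left: "bform (x - y) z = bform x z - bform y z"
  using bform_add_left[of x "- y" z] by (simp add: bform_minus_left)

lemma bform_diff_right: "bform x (y - z) = bform x y - bform x z"
  by (metis bform_diff_left bform_sym)

lemmas bform_linear = bform_add_left bform_add_right bform_scale_left bform_scale_right
  bform_minus_left bform_minus_right bform_diff_left bform_diff_right

lemma hform_eq_bform_sig: "hform x y = bform x (sig y)"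
  by (simp add: hform_def bform_def lookup_sig ac_simps)

lemma bform_sig_sig: "bform (sig x) (sig y) = cnj (bform x y)"
  unfolding bform_def keys_sig cnj_sum by (rule sum.cong) (auto simp: lookup_sig)

lemma bform_evec_left: "bform (evec j) v = coord v j"
  by (simp add: bform_evec_right bform_sym[of "evec j"])

section \<open>Rotations of an orthonormal plane\<close>

definition orthonormal2 :: "V \<Rightarrow> V \<Rightarrow> bool"
  where "orthonormal2 e f \<longleftrightarrow> bform e e = 1 \<and> bform f f = 1 \<and> bform e f = 0"

text \<open>For orthonormal \<open>e\<close>, \<open>f\<close> this is the rotation of their plane
  by the complex angle \<open>t\<close>, with the orthogonal complement fixed. Writing it as the
  identity plus a correction in the plane avoids choosing a complement.\<close>

definition rot :: "V \<Rightarrow> V \<Rightarrow> complex \<Rightarrow> V \<Rightarrow> V"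
  where "rot e f t z = z
    + scale ((cos t - 1) * bform z e - sin t * bform z f) e
    + scale ((cos t - 1) * bform z f + sin t * bform z e) f"

lemma bform_rot_axis:
  assumes "orthonormal2 e f"
  shows "bform (rot e f t z) e = cos t * bform z e - sin t * bform z f"
    and "bform (rot e f t z) f = cos t * bform z f + sin t * bform z e"
  using assms bform_sym[of f e]
  by (simp_all add: rot_def orthonormal2_def bform_linear) (simp_all add: algebra_simps)

lemma rot_zero [simp]: "rot e f 0 z = z"
  by (rule poly_mapping_eqI) (simp add: rot_def lookup_add)

lemma rot_rot:
  assumes "orthonormal2 e f"
  shows "rot e f s (rot e f t z) = rot e f (s + t) z"
  unfolding rot_def[of e f s "rot e f t z"] bform_rot_axis[OF assms]
  by (rule poly_mapping_eqI) (simp add: rot_def lookup_add cos_add sin_add algebra_simps)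

lemma bform_rot:
  assumes "orthonormal2 e f"
  shows "bform (rot e f t x) (rot e f t y) = bform x y"
proof -
  have "bform (rot e f t x) (rot e f t y) = bform (rot e f t x) y
      + ((cos t - 1) * bform y e - sin t * bform y f) * bform (rot e f t x) e
      + ((cos t - 1) * bform y f + sin t * bform y e) * bform (rot e f t x) f"
    by (subst (2) rot_def) (simp add: bform_linear)
  also have "\<dots> = bform x y
      + ((cos t - 1) * bform x e - sin t * bform x f) * bform y e
      + ((cos t - 1) * bform x f + sin t * bform x e) * bform y f
      + ((cos t - 1) * bform y e - sin t * bform y f) * (cos t * bform x e - sin t * bform x f)
      + ((cos t - 1) * bform y f + sin t * bform y e) * (cos t * bform x f + sin t * bform x e)"
    unfolding bform_rot_axis[OF assms]
    by (subst rot_def) (simp add: bform_linear bform_sym[of _ y])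
  \<comment> \<open>The mixed terms cancel, and the rest carries the factor by which the Pythagorean
    identity fails.\<close>
  also have "\<dots> = bform x y + (bform x e * bform y e + bform x f * bform y f) *
      ((sin t)\<^sup>2 + (cos t)\<^sup>2 - 1)"
    by (simp add: algebra_simps power2_eq_square del: sin_cos_squared_add sin_cos_squared_add2 sin_cos_squared_add3)
  finally show ?thesis by simp
qed

lemma linear_rot: "Vector_Spaces.linear scale scale (rot e f t)"
  by unfold_locales (rule poly_mapping_eqI, simp add: rot_def bform_linear lookup_add algebra_simps)+

lemma moved_rot: "moved (rot e f t) \<subseteq> Poly_Mapping.keys e \<union> Poly_Mapping.keys f"
proof
  fix i assume i: "i \<in> moved (rot e f t)"
  show "i \<in> Poly_Mapping.keys e \<union> Poly_Mapping.keys f"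
  proof (rule ccontr)
    assume "i \<notin> Poly_Mapping.keys e \<union> Poly_Mapping.keys f"
    then have "rot e f t (evec i) = evec i"
      by (intro poly_mapping_eqI) (simp add: rot_def bform_evec_left in_keys_iff lookup_add)
    then show False using i by (simp add: moved_def)
  qed
qed

lemma finite_moved_rot: "finite (moved (rot e f t))"
  using moved_rot by (rule finite_subset) simp

text \<open>The determinant is a square because the rotation has a square root, and it is a square of
  \<open>\<plusminus>1\<close>.\<close>

lemma fdet_rot:
  assumes "orthonormal2 e f"
  shows "fdet (rot e f t) = 1"
proof -
  have "rot e f t = rot e f (t / 2) \<circ> rot e f (t / 2)"
    by (auto simp: rot_rot[OF assms])
  then have "fdet (rot e f t) = fdet (rot e f (t / 2)) * fdet (rot e f (t / 2))"
    using fdet_comp[OF linear_rot finite_moved_rot finite_moved_rot] by metis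
  also have "\<dots> = 1"
    by (intro fdet_square finite_moved_rot bform_rot assms)
  finally show ?thesis .
qed

text \<open>Each axis is real or purely imaginary with respect to \<^term>\<open>sig\<close>. The angle is real if both are
  of the same kind and imaginary (a boost) otherwise, so that the rotation commutes with \<^term>\<open>sig\<close>.\<close>

definition admissible :: "V \<Rightarrow> V \<Rightarrow> complex \<Rightarrow> bool"
  where "admissible e f t \<longleftrightarrow> orthonormal2 e f \<and>
    (\<exists>r\<in>{1, -1}. \<exists>s\<in>{1, -1}. sig e = scale r e \<and> sig f = scale s f \<and> cnj t = r * s * t)"

lemma admissible_scale: "admissible e f t \<Longrightarrow> admissible e f (complex_of_real a * t)"
  by (auto simp: admissible_def)

lemma admissible_minus: "admissible e f t \<Longrightarrow> admissible e f (- t)"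
  using admissible_scale[of e f t "-1"] by simp

text \<open>Conjugation turns \<open>bform z e\<close> and \<open>bform z f\<close> into
  \<open>r\<close> and \<open>s\<close> times the products with \<open>sig z\<close>, and
  \<open>sin t\<close> into \<open>r * s * sin t\<close>. These signs cancel against those of
  \<open>sig e\<close> and \<open>sig f\<close>.\<close>

lemma sig_rot:
  assumes "admissible e f t"
  shows "sig (rot e f t z) = rot e f t (sig z)"
proof -
  obtain r s where rs: "r \<in> {1, -1}" "s \<in> {1, -1}" "sig e = scale r e" "sig f = scale s f"
      "cnj t = r * s * t"
    using assms unfolding admissible_def by blast
  have r: "r * r = 1" "cnj r = r" and s: "s * s = 1" "cnj s = s"
    using rs by auto
  have ce: "cnj (bform z e) = r * bform (sig z) e" "cnj (bform z f) = s * bform (sig z) f"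
    by (simp_all add: rs bform_linear flip: bform_sig_sig)
  \<comment> \<open>Cosine is even, sine is odd, and \<open>r * s\<close> is a sign.\<close>
  have ct: "cos (cnj t) = cos t" "sin (cnj t) = r * s * sin t"
    using rs by auto
  show ?thesis
    unfolding rot_def sig_add sig_scale rs(3,4)
    using rs(1,2)
    by (intro poly_mapping_eqI) (auto simp: lookup_add ce ct cnj_cos cnj_sin algebra_simps)
qed

lemma hform_rot: "admissible e f t \<Longrightarrow> hform (rot e f t x) (rot e f t y) = hform x y"
  by (simp add: hform_eq_bform_sig sig_rot bform_rot admissible_def)

section \<open>Rotations in the groups\<close>

lemma SO_inf_rot_comp:
  assumes e: "orthonormal2 e f" and g: "g \<in> SO_inf"
  shows "rot e f t \<circ> g \<in> SO_inf"
proof -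
  have lin: "Vector_Spaces.linear scale scale g" and fin: "finite (moved g)"
    and b: "bform (g x) (g y) = bform x y" and d: "fdet g = 1" for x y
    using g by (auto simp: SO_inf_def)
  have "Vector_Spaces.linear scale scale (rot e f t \<circ> g)"
    using lin linear_rot Vector_Spaces.linear_compose by blast
  moreover have "finite (moved (rot e f t \<circ> g))"
    using moved_comp by (rule finite_subset) (simp add: fin finite_moved_rot)
  moreover have "fdet (rot e f t \<circ> g) = 1"
    by (simp add: fdet_comp linear_rot finite_moved_rot fin fdet_rot e d)
  ultimately show ?thesis
    by (simp add: SO_inf_def bform_rot e b)
qed

lemma SO_inf_h_rot_comp:
  assumes "admissible e f t" and "g \<in> SO_inf_h"
  shows "rot e f t \<circ> g \<in> SO_inf_h"
  using assms by (simp add: SO_inf_h_def hform_rot) (simp add: admissible_def SO_inf_rot_comp)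

lemma id_in_SO_inf_h: "id \<in> SO_inf_h"
proof -
  have "moved id = {}" by (simp add: moved_def)
  then have "fdet id = 1" by (simp add: fdet_def leibniz_def)
  moreover have "Vector_Spaces.linear scale scale id"
    by unfold_locales auto
  ultimately show ?thesis using \<open>moved id = {}\<close> by (simp add: SO_inf_h_def SO_inf_def)
qed

lemma finite_idx_bound:
  assumes "finite S" shows "\<exists>n. \<forall>i\<in>S. - int n \<le> Rep_idx i"
proof -
  obtain m where m: "\<And>i. i \<in> S \<Longrightarrow> nat (- Rep_idx i) \<le> m"
    using assms finite_nat_set_iff_bounded_le[of "(\<lambda>i. nat (- Rep_idx i)) ` S"] by auto
  show ?thesis by (rule exI[of _ m]) (use m in force)
qed

text \<open>A stage of a direct limit maps continuously into it, so continuity of a path can be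
  checked in a single \<open>SO_n n\<close>.\<close>

lemma continuous_map_into_SO_inf_top:
  assumes "continuous_map X (SO_n_top n) \<gamma>"
  shows "continuous_map X SO_inf_top \<gamma>"
proof -
  have sub: "SO_n n \<subseteq> SO_inf" by (auto simp: SO_n_def)
  have "openin X {x \<in> topspace X. \<gamma> x \<in> U}" if U: "openin SO_inf_top U" for U
  proof -
    have "openin (SO_n_top n) (U \<inter> SO_n n)"
      using U by (auto simp: SO_inf_top_def openin_direct_limit_topology topspace_SO_n_top)
    then have "openin X {x \<in> topspace X. \<gamma> x \<in> U \<inter> SO_n n}"
      using assms by (auto simp: continuous_map_def)
    moreover have "\<gamma> x \<in> SO_n n" if "x \<in> topspace X" for x
      using assms that by (auto simp: continuous_map_def topspace_SO_n_top)
    then have "{x \<in> topspace X. \<gamma> x \<in> U \<inter> SO_n n} = {x \<in> topspace X. \<gamma> x \<in> U}" by auto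
    ultimately show ?thesis by simp
  qed
  then show ?thesis
    using assms sub by (auto simp: continuous_map_def topspace_SO_inf_top topspace_SO_n_top)
qed

text \<open>Letting the angle grow from \<open>0\<close> to \<open>t\<close> gives a path in
  \<open>SO_inf_h\<close> from \<open>g\<close> to the rotated \<open>g\<close>.\<close>

lemma G0_rot_comp:
  assumes a: "admissible e f t" and g: "g \<in> carrier G0"
  shows "rot e f t \<circ> g \<in> carrier G0"
proof -
  let ?X = "subtopology SO_inf_top SO_inf_h"
  have gh: "g \<in> SO_inf_h" and conn: "connected_component_of ?X id g"
    using g connected_component_of_subset_topspace[of ?X id]
    by (auto simp: G0_def topspace_SO_inf_top)
  define \<gamma> where "\<gamma> s = rot e f (complex_of_real s * t) \<circ> g" for s
  have \<gamma>h: "\<gamma> s \<in> SO_inf_h" for s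
    unfolding \<gamma>_def by (intro SO_inf_h_rot_comp admissible_scale a gh)
  have fin: "finite (moved g)" using gh by (auto simp: SO_inf_h_def SO_inf_def)
  \<comment> \<open>This stage contains the whole path: \<open>n\<close> bounds all indices that
    \<open>g\<close> or one of the rotations can move.\<close>
  obtain n where n: "\<And>i. i \<in> moved g \<union> Poly_Mapping.keys e \<union> Poly_Mapping.keys f \<Longrightarrow> - int n \<le> Rep_idx i"
    using finite_idx_bound[of "moved g \<union> Poly_Mapping.keys e \<union> Poly_Mapping.keys f"] fin by auto
  have "\<gamma> s \<in> SO_n n" for s
  proof -
    have "i \<notin> moved (\<gamma> s)" if "Rep_idx i < - int n" for i
      using moved_comp moved_rot n[of i] that unfolding \<gamma>_def by fastforce
    then show ?thesis using \<gamma>h[of s] by (auto simp: SO_n_def SO_inf_h_def moved_def)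
  qed
  moreover have "continuous_on {0..1} (\<lambda>s. \<lambda>i j. coord (\<gamma> s (evec j)) i)"
    by (intro continuous_on_coordinatewise_then_product)
      (simp add: \<gamma>_def rot_def lookup_add continuous_intros)
  ultimately have "continuous_map (top_of_set {0..1}) (SO_n_top n) \<gamma>"
    unfolding SO_n_top_def by (intro continuous_map_pullback') (auto simp: o_def)
  then have "continuous_map (top_of_set {0..1}) ?X \<gamma>"
    using \<gamma>h by (auto simp: continuous_map_in_subtopology intro: continuous_map_into_SO_inf_top)
  then have "connectedin ?X (\<gamma> ` {0..1})"
    by (rule connectedin_continuous_map_image) (simp add: connectedin_subtopology)
  then have "connected_component_of ?X (\<gamma> 0) (\<gamma> 1)"
    unfolding connected_component_of_def by (intro exI[of _ "\<gamma> ` {0..1}"]) auto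
  moreover have "\<gamma> 0 = g" "\<gamma> 1 = rot e f t \<circ> g"
    by (auto simp: \<gamma>_def)
  ultimately show ?thesis
    using conn connected_component_of_trans by (fastforce simp: G0_def)
qed

lemma id_in_G0: "id \<in> carrier G0"
  using id_in_SO_inf_h
  by (simp add: G0_def connected_component_of_refl topspace_SO_inf_top SO_inf_h_def)

lemma G0_subset: "carrier G0 \<subseteq> SO_inf_h"
  using connected_component_of_subset_topspace[of "subtopology SO_inf_top SO_inf_h" id]
  by (auto simp: G0_def topspace_SO_inf_top)

section \<open>Reachability by rotations and scalars\<close>

inductive reach :: "V \<Rightarrow> V \<Rightarrow> bool" where
  refl: "reach v v"
| rot: "reach v w \<Longrightarrow> admissible e f t \<Longrightarrow> reach v (rot e f t w)"
| scale: "reach v w \<Longrightarrow> c \<noteq> 0 \<Longrightarrow> reach v (scale c w)"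

lemma reach_trans: "reach v w \<Longrightarrow> reach u v \<Longrightarrow> reach u w"
  by (induction rule: reach.induct) (auto intro: reach.intros)

lemma reach_sym: "reach v w \<Longrightarrow> reach w v"
proof (induction rule: reach.induct)
  case (rot v w e f t)
  have "reach (rot e f t w) (rot e f (- t) (rot e f t w))"
    using rot.hyps(2) by (intro reach.intros admissible_minus)
  moreover have "rot e f (- t) (rot e f t w) = w"
    using rot.hyps(2) by (simp add: rot_rot admissible_def)
  ultimately have "reach (rot e f t w) w" by simp
  then show ?case using rot.IH by (rule reach_trans[rotated])
next
  case (scale v w c)
  have "reach (scale c w) (scale (inverse c) (scale c w))"
    using scale.hyps(2) by (intro reach.intros) auto
  then have "reach (scale c w) w"
    using scale.hyps(2) by simp
  then show ?case using scale.IH by (rule reach_trans[rotated])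
qed (rule reach.refl)

lemma pt_scale: "c \<noteq> 0 \<Longrightarrow> pt (scale c v) = pt v"
proof -
  assume c: "c \<noteq> 0"
  have "range (\<lambda>k. scale k (scale c v)) = range (\<lambda>k. scale k v)"
  proof (rule antisym; rule image_subsetI)
    fix k show "scale k v \<in> range (\<lambda>k. scale k (scale c v))"
      using c by (intro image_eqI[of _ _ "k * inverse c"]) auto
  qed auto
  then show ?thesis by (simp add: pt_def V.span_singleton)
qed

text \<open>A rotation is composed with the group element found so far, and a scalar leaves the line
  unchanged.\<close>

lemma reach_G0: "reach v w \<Longrightarrow> \<exists>g\<in>carrier G0. pt (g v) = pt w"
proof (induction rule: reach.induct)
  case (refl v)
  then show ?case using id_in_G0 by (intro bexI[of _ id]) simp_all
next
  case (rot v w e f t)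
  then obtain g where "g \<in> carrier G0" "pt (g v) = pt w" by blast
  then show ?case
    using rot.hyps(2) by (intro bexI[OF _ G0_rot_comp]) (auto simp flip: act_pt[OF linear_rot])
next
  case (scale v w c)
  then show ?case by (simp add: pt_scale)
qed

section \<open>Normal forms of isotropic vectors\<close>

abbreviation i1 :: idx where "i1 \<equiv> Abs_idx 1"
abbreviation i2 :: idx where "i2 \<equiv> Abs_idx 2"

lemma Rep_idx_neg: "k < 0 \<Longrightarrow> Rep_idx (Abs_idx k) = k"
  by (simp add: Abs_idx_inverse)

lemma Rep_idx_pos [simp]: "Rep_idx i1 = 1" "Rep_idx i2 = 2"
  by (simp_all add: Abs_idx_inverse)

lemma i1_i2 [simp]: "i1 \<noteq> i2" "i2 \<noteq> i1"
  by (simp_all flip: Rep_idx_inject)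

lemma Rep_idx_cases: "Rep_idx i < 0 \<or> i = i1 \<or> i = i2"
  using Rep_idx[of i] by (auto simp flip: Rep_idx_inject)

lemma coord_evec: "coord (evec i) j = (if i = j then 1 else 0)"
  by (simp add: evec_def lookup_single when_def)

lemma sig_evec: "sig (evec i) = scale (if Rep_idx i < 0 then 1 else -1) (evec i)"
  by (rule poly_mapping_eqI) (simp add: lookup_sig coord_evec)

lemma rot_plane:
  assumes "orthonormal2 e f" "bform z e = 0" "bform z f = 0"
  shows "rot e f t (z + scale c e) = z + scale (c * cos t) e + scale (c * sin t) f"
  using assms bform_sym[of f e]
  by (intro poly_mapping_eqI)
    (simp add: rot_def orthonormal2_def bform_linear lookup_add lookup_minus algebra_simps)

section \<open>Real and imaginary parts with respect to \<open>sig\<close>\<close>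

definition re_part :: "V \<Rightarrow> V" where "re_part v = scale (1/2) (v + sig v)"
definition im_part :: "V \<Rightarrow> V" where "im_part v = scale (- \<i>/2) (v - sig v)"

lemma re_im_part: "v = re_part v + scale \<i> (im_part v)"
  by (rule poly_mapping_eqI) (simp add: re_part_def im_part_def lookup_add lookup_minus algebra_simps)

lemma sig_re_part: "sig (re_part v) = re_part v"
  by (simp add: re_part_def sig_add sig_diff sig_minus sig_scale sig_sig add.commute)

lemma sig_im_part: "sig (im_part v) = im_part v"
  by (rule poly_mapping_eqI)
    (simp add: im_part_def sig_add sig_diff sig_minus sig_scale sig_sig lookup_add lookup_minus algebra_simps)

text \<open>For isotropic \<open>v\<close> the two parts are thus orthogonal, and both have square
  \<open>hform v v / 2\<close>.\<close>

lemma bform_re_im_part: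
  "bform (re_part v) (re_part v) = (Re (bform v v) + hform v v) / 2"
  "bform (im_part v) (im_part v) = (hform v v - Re (bform v v)) / 2"
  "bform (re_part v) (im_part v) = Im (bform v v) / 2"
proof -
  have s: "bform (sig v) (sig v) = cnj (bform v v)" "bform (sig v) v = hform v v"
    "bform v (sig v) = hform v v"
    by (simp_all add: bform_sig_sig hform_eq_bform_sig bform_sym[of "sig v" v])
  show "bform (re_part v) (re_part v) = (Re (bform v v) + hform v v) / 2"
    by (simp add: re_part_def bform_linear s) (simp add: complex_eq_iff field_simps)
  show "bform (im_part v) (im_part v) = (hform v v - Re (bform v v)) / 2"
    by (simp add: im_part_def bform_linear s) (simp add: complex_eq_iff field_simps)
  show "bform (re_part v) (im_part v) = Im (bform v v) / 2"
    by (simp add: re_part_def im_part_def bform_linear s) (simp add: complex_eq_iff field_simps)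
qed

lemma hform_scale: "hform (scale c x) (scale c x) = (cmod c)\<^sup>2 * hform x x"
proof -
  have "hform (scale c x) (scale c x) = (c * cnj c) * hform x x"
    by (simp add: hform_eq_bform_sig sig_scale bform_linear)
  then show ?thesis by (simp only: complex_norm_square)
qed

lemma hform_self: "hform v v = Re (hform v v)"
  using hform_self_real[of v] by simp

text \<open>The real and imaginary parts of \<open>v\<close> are turned separately, by quarter turns, into two basis
  vectors that do not occur in \<open>v\<close>.\<close>

lemma reach_positive:
  assumes v: "bform v v = 0" "Re (hform v v) > 0"
    and a: "Rep_idx a < 0" "coord v a = 0" and b: "Rep_idx b < 0" "coord v b = 0" and ab: "a \<noteq> b"
  shows "reach v (evec a + scale \<i> (evec b))"
proof -
  \<comment> \<open>The scalar makes \<open>hform w w = 2\<close>, so that the real and imaginary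
    parts of \<open>w\<close> become unit vectors.\<close>
  define k where "k = complex_of_real (sqrt (2 / Re (hform v v)))"
  define w where "w = scale k v"
  have k0: "k \<noteq> 0" using v(2) by (simp add: k_def)
  have "hform w w = (cmod k)\<^sup>2 * hform v v"
    by (simp add: w_def hform_scale)
  also have "\<dots> = complex_of_real ((cmod k)\<^sup>2 * Re (hform v v))"
    by (subst hform_self) simp
  also have "(cmod k)\<^sup>2 * Re (hform v v) = 2"
    using v(2) by (simp add: k_def)
  finally have hw: "hform w w = 2" by simp
  have bw: "bform w w = 0" by (simp add: w_def bform_linear v)
  let ?x = "re_part w" and ?y = "im_part w"
  note b_xy = bform_re_im_part[of w, simplified bw hw, simplified]
  have coord: "coord ?x a = 0" "coord ?x b = 0" "coord ?y a = 0" "coord ?y b = 0"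
    using a b by (simp_all add: re_part_def im_part_def w_def lookup_add lookup_minus lookup_sig)
  have admissible: "admissible ?x (evec a) (pi / 2)" "admissible ?y (evec b) (pi / 2)"
    using a b coord b_xy
    by (auto simp: admissible_def orthonormal2_def bform_evec bform_evec_right coord_evec sig_re_part sig_im_part sig_evec)
  \<comment> \<open>The quarter turn takes \<open>?x\<close> to \<open>evec a\<close>, while
    \<open>?y\<close> is orthogonal to the plane and stays.\<close>
  have "rot ?x (evec a) (pi / 2) (scale \<i> ?y + scale 1 ?x) = scale \<i> ?y + evec a"
    using coord b_xy admissible(1)
    by (subst rot_plane) (simp_all add: admissible_def bform_linear bform_evec_right bform_sym[of ?y ?x] cos_of_real sin_of_real)
  then have 1: "rot ?x (evec a) (pi / 2) w = evec a + scale \<i> ?y"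
    by (subst re_im_part) (simp add: add.commute)
  have 2: "rot ?y (evec b) (pi / 2) (evec a + scale \<i> ?y) = evec a + scale \<i> (evec b)"
    using coord admissible(2) ab
    by (subst rot_plane) (simp_all add: admissible_def bform_evec bform_evec_left coord_evec cos_of_real sin_of_real)
  have "reach v w"
    using k0 unfolding w_def by (intro reach.intros)
  then show ?thesis
    using admissible unfolding 1[symmetric] 2[symmetric] by (intro reach.rot)
qed

section \<open>Spacelike vectors and boosts\<close>

lemma hform_sum:
  "hform v v = (\<Sum>i\<in>Poly_Mapping.keys v. (if Rep_idx i < 0 then 1 else -1) * (cmod (coord v i))\<^sup>2)"
  unfolding hform_def of_real_sum by (intro sum.cong refl) (auto simp: mult.assoc complex_mult_cnj cmod_power2)

definition spacelike :: "V \<Rightarrow> bool"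
  where "spacelike v \<longleftrightarrow> coord v i1 = 0 \<and> coord v i2 = 0"

lemma spacelike_hform:
  assumes "spacelike v"
  shows "Re (hform v v) = (\<Sum>i\<in>Poly_Mapping.keys v. (cmod (coord v i))\<^sup>2)"
proof -
  have "Rep_idx i < 0" if "i \<in> Poly_Mapping.keys v" for i
    using that assms Rep_idx_cases[of i] by (auto simp: spacelike_def in_keys_iff)
  then show ?thesis unfolding hform_sum by simp
qed

text \<open>The triangle inequality. Through \<open>timelike_pc_qc\<close> this bound separates the
  two negative orbits.\<close>

lemma spacelike_bform_le:
  assumes "spacelike v" shows "cmod (bform v v) \<le> Re (hform v v)"
  unfolding spacelike_hform[OF assms] bform_def
  by (rule order.trans[OF norm_sum]) (simp add: norm_mult power2_eq_square)

lemma spacelike_eq_0: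
  assumes "spacelike v" "hform v v = 0" shows "v = 0"
proof (rule poly_mapping_eqI)
  fix i
  have "(\<Sum>i\<in>Poly_Mapping.keys v. (cmod (coord v i))\<^sup>2) = 0"
    using spacelike_hform[OF assms(1)] assms(2) by simp
  then have "\<forall>i\<in>Poly_Mapping.keys v. (cmod (coord v i))\<^sup>2 = 0"
    by (subst (asm) sum_nonneg_eq_0_iff) auto
  then show "coord v i = coord 0 i" by (auto simp: in_keys_iff)
qed

text \<open>A rotation by \<open>\<i> * \<tau>\<close> has cosine \<open>cosh \<tau>\<close> and
  sine \<open>\<i> * sinh \<tau>\<close>, so it turns a multiple of \<open>e\<close> into one of
  larger or equal size plus an imaginary multiple of \<open>u\<close>.\<close>

lemma reach_boost:
  assumes e: "e = evec i1 \<or> e = evec i2" and u: "spacelike u" "sig u = u" "bform u u = complex_of_real N"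
    and z: "bform z e = 0" "bform z u = 0"
    and a: "\<alpha> > 0" "r > 0" "\<alpha>\<^sup>2 = r\<^sup>2 + N"
  shows "reach (z + scale (c * complex_of_real r) e)
    (z + scale (c * complex_of_real \<alpha>) e + scale (c * \<i>) u)"
proof -
  have hu: "hform u u = complex_of_real N"
    using u by (simp add: hform_eq_bform_sig)
  then have "N \<ge> 0"
    using spacelike_hform[OF u(1)] by (simp add: sum_nonneg)
  then consider "N = 0" | "N > 0" by linarith
  then show ?thesis
  proof cases
    case 1
    \<comment> \<open>Here \<open>u\<close> cannot be normalised, but definiteness makes it
      zero.\<close>
    then have "u = 0" using spacelike_eq_0[OF u(1)] hu by simp
    moreover have "\<alpha> = r" using a 1 by (simp add: power2_eq_iff)
    ultimately show ?thesis by (simp add: reach.refl)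
  next
    case 2
    define f where "f = scale (1 / complex_of_real (sqrt N)) u"
    \<comment> \<open>With \<open>sinh \<tau> = sqrt N / r\<close> the relation between
      \<open>\<alpha>\<close>, \<open>r\<close> and \<open>N\<close> forces
      \<open>cosh \<tau> = \<alpha> / r\<close>.\<close>
    define \<tau> where "\<tau> = arsinh (sqrt N / r)"
    have sq: "complex_of_real (sqrt N) * complex_of_real (sqrt N) = complex_of_real N"
      using 2 by (simp flip: of_real_mult)
    have ee: "bform e e = 1" "bform e u = 0" "sig e = scale (-1) e"
      using e u(1) by (auto simp: bform_evec bform_evec_left coord_evec spacelike_def sig_evec)
    have on: "orthonormal2 e f"
      using 2 by (simp add: orthonormal2_def f_def bform_linear ee u(3) sq)
    \<comment> \<open>The axis \<open>e\<close> is imaginary and \<open>f\<close> is real for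
      \<open>sig\<close>, so the angle has to be imaginary.\<close>
    have "admissible e f (\<i> * complex_of_real \<tau>)"
      using on ee(3) u(2) unfolding admissible_def by (intro conjI bexI[of _ "-1"] bexI[of _ 1]) (auto simp: f_def sig_scale)
    then have "reach (z + scale (c * r) e) (rot e f (\<i> * \<tau>) (z + scale (c * r) e))"
      by (intro reach.intros)
    also have "rot e f (\<i> * \<tau>) (z + scale (c * r) e) =
        z + scale (c * r * cos (\<i> * \<tau>)) e + scale (c * r * sin (\<i> * \<tau>)) f"
      by (rule rot_plane[OF on]) (simp_all add: z f_def bform_linear)
    also have "cos (\<i> * \<tau>) = cosh (complex_of_real \<tau>)"
      by (simp add: cosh_conv_cos)
    also have "\<dots> = complex_of_real (cosh \<tau>)"
      by (simp add: cosh_def exp_of_real scaleR_conv_of_real flip: of_real_minus)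
    also have "cosh \<tau> = \<alpha> / r"
    proof -
      have "cosh \<tau> = sqrt ((sqrt N / r)\<^sup>2 + 1)"
        by (simp add: \<tau>_def cosh_arsinh_real)
      also have "(sqrt N / r)\<^sup>2 + 1 = (\<alpha> / r)\<^sup>2"
        using a 2 by (simp add: field_simps)
      finally show ?thesis using a by simp
    qed
    also have "sin (\<i> * \<tau>) = \<i> * sinh (complex_of_real \<tau>)"
      by (simp add: sinh_conv_sin)
    also have "sinh (complex_of_real \<tau>) = complex_of_real (sinh \<tau>)"
      by (simp add: sinh_def exp_of_real scaleR_conv_of_real flip: of_real_minus)
    also have "sinh \<tau> = sqrt N / r"
      by (simp add: \<tau>_def)
    also have "c * r * complex_of_real (\<alpha> / r) = c * \<alpha>"
      using a by simp
    also have "scale (c * r * (\<i> * complex_of_real (sqrt N / r))) f = scale (c * \<i>) u"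
      using a 2 by (simp add: f_def)
    finally show ?thesis .
  qed
qed

text \<open>One boost mixes \<open>evec i1\<close> with \<open>n\<close>, the other mixes
  \<open>evec i2\<close> with \<open>m\<close>; the two planes are orthogonal. The equation between
  \<open>\<alpha>\<close>, \<open>\<beta>\<close>, \<open>M\<close> and \<open>N\<close> lets both
  start from the same length \<open>r\<close>.\<close>

lemma reach_neg_normal:
  fixes \<alpha> \<beta> M N :: real
  assumes m: "spacelike m" "sig m = m" "bform m m = complex_of_real M"
    and n: "spacelike n" "sig n = n" "bform n n = complex_of_real N"
    and mn: "bform m n = 0" and ab: "\<alpha> > 0" "\<beta> \<noteq> 0" "N < \<alpha>\<^sup>2" "\<alpha>\<^sup>2 - N = \<beta>\<^sup>2 - M"
  shows "reach (evec i1 + scale (\<i> * complex_of_real (sgn \<beta>)) (evec i2))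
    (scale \<alpha> (evec i1) + scale (\<i> * \<beta>) (evec i2) + (m + scale \<i> n))"
proof -
  define r where "r = sqrt (\<alpha>\<^sup>2 - N)"
  have r: "r > 0" "r\<^sup>2 = \<alpha>\<^sup>2 - N" using ab by (simp_all add: r_def)
  let ?d = "complex_of_real (sgn \<beta>)"
  have d: "?d * ?d = 1" using ab(2) by (simp add: sgn_if)
  let ?z = "scale (r * ?d * \<i>) (evec i2)"
  let ?z' = "scale \<alpha> (evec i1) + scale \<i> n"
  have "reach (evec i1 + scale (\<i> * ?d) (evec i2)) (scale r (evec i1 + scale (\<i> * ?d) (evec i2)))"
    using r by (intro reach.intros) simp
  also have "scale r (evec i1 + scale (\<i> * ?d) (evec i2)) = ?z + scale (1 * complex_of_real r) (evec i1)"
    by (rule poly_mapping_eqI) (simp add: lookup_add lookup_minus algebra_simps)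
  finally have 1: "reach (evec i1 + scale (\<i> * ?d) (evec i2)) (?z + scale (1 * complex_of_real r) (evec i1))" .
  have 2: "reach (?z + scale (1 * complex_of_real r) (evec i1))
      (?z + scale (1 * complex_of_real \<alpha>) (evec i1) + scale (1 * \<i>) n)"
    using n r ab
    by (intro reach_boost[where N = N]) (auto simp: bform_linear bform_evec bform_evec_left coord_evec spacelike_def)
  have eq: "?z + scale (1 * complex_of_real \<alpha>) (evec i1) + scale (1 * \<i>) n =
      ?z' + scale ((\<i> * ?d) * complex_of_real r) (evec i2)"
    by (rule poly_mapping_eqI) (simp add: lookup_add lookup_minus algebra_simps)
  \<comment> \<open>The second boost multiplies this vector by
    \<open>(\<i> * ?d) * \<i> = - ?d\<close>, which gives \<open>m\<close>.\<close>
  let ?u = "scale (- ?d) m"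
  have 3: "reach (?z' + scale ((\<i> * ?d) * complex_of_real r) (evec i2))
      (?z' + scale ((\<i> * ?d) * complex_of_real \<bar>\<beta>\<bar>) (evec i2) + scale ((\<i> * ?d) * \<i>) ?u)"
  proof (rule reach_boost[where N = M])
    show "spacelike ?u" using m(1) by (simp add: spacelike_def)
    show "sig ?u = ?u" by (simp add: sig_scale sig_minus m(2))
    show "bform ?u ?u = M" using d by (simp add: bform_linear m(3) flip: mult.assoc)
    show "bform ?z' (evec i2) = 0" "bform ?z' ?u = 0"
      using m(1) n(1) mn by (auto simp: lookup_add bform_linear bform_evec bform_evec_right bform_evec_left coord_evec spacelike_def bform_sym[of n m])
  qed (use r ab in auto)
  have "?z' + scale ((\<i> * ?d) * complex_of_real \<bar>\<beta>\<bar>) (evec i2) + scale ((\<i> * ?d) * \<i>) ?u =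
      scale \<alpha> (evec i1) + scale (\<i> * \<beta>) (evec i2) + (m + scale \<i> n)"
    using ab(2) d by (intro poly_mapping_eqI) (auto simp: lookup_add lookup_minus sgn_if algebra_simps)
  with reach_trans[OF 3 reach_trans[OF 2[unfolded eq] 1]] show ?thesis by (simp only:)
qed

text \<open>The part of \<^term>\<open>bform v v\<close> coming from \<open>e\<^sub>1, e\<^sub>2\<close> factors as \<^term>\<open>pc v * qc v\<close>, and rotations of the
  plane of \<open>e\<^sub>1, e\<^sub>2\<close> act on the two factors by inverse phases.\<close>

definition pc :: "V \<Rightarrow> complex" where "pc v = coord v i1 - \<i> * coord v i2"
definition qc :: "V \<Rightarrow> complex" where "qc v = coord v i1 + \<i> * coord v i2"

definition space_part :: "V \<Rightarrow> V"
  where "space_part v = v - scale (coord v i1) (evec i1) - scale (coord v i2) (evec i2)"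

lemma spacelike_space_part: "spacelike (space_part v)"
  by (simp add: spacelike_def space_part_def lookup_add lookup_minus coord_evec)

lemma space_part_split:
  "v = scale (coord v i1) (evec i1) + scale (coord v i2) (evec i2) + space_part v"
  by (rule poly_mapping_eqI) (simp add: space_part_def lookup_add lookup_minus)

lemma bform_space_part: "bform (space_part v) (space_part v) = bform v v - pc v * qc v"
proof -
  have "bform (space_part v) (space_part v) = bform v v - coord v i1 * coord v i1 - coord v i2 * coord v i2"
    unfolding space_part_def
    by (simp add: bform_linear bform_evec bform_evec_left bform_evec_right coord_evec lookup_minus)
  then show ?thesis
    by (simp add: pc_def qc_def algebra_simps)
qed

text \<open>The parallelogram law expresses the contribution of the first two axes through
  \<open>pc v\<close> and \<open>qc v\<close>.\<close>

lemma hform_space_part: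
  "Re (hform (space_part v) (space_part v)) = Re (hform v v) + ((cmod (pc v))\<^sup>2 + (cmod (qc v))\<^sup>2) / 2"
proof -
  have "hform (space_part v) (space_part v) =
      hform v v + coord v i1 * cnj (coord v i1) + coord v i2 * cnj (coord v i2)"
    unfolding space_part_def hform_eq_bform_sig
    by (simp add: lookup_minus sig_add sig_diff sig_minus sig_scale sig_evec bform_linear bform_evec bform_evec_left coord_evec bform_evec_right lookup_sig)
  then show ?thesis
    unfolding cmod_power2 pc_def qc_def by (simp add: power2_eq_square algebra_simps)
qed

text \<open>The space part \<open>z\<close> has
  \<open>cmod (bform z z) = cmod (pc v) * cmod (qc v)\<close>. If the moduli agreed, the bound by
  \<open>hform z z\<close> would force \<open>Re (hform v v)\<close> to be nonnegative.\<close>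

lemma timelike_pc_qc:
  assumes "bform v v = 0" "Re (hform v v) < 0"
  shows "cmod (pc v) \<noteq> cmod (qc v)"
proof
  assume eq: "cmod (pc v) = cmod (qc v)"
  have "cmod (pc v) * cmod (qc v) \<le> Re (hform v v) + ((cmod (pc v))\<^sup>2 + (cmod (qc v))\<^sup>2) / 2"
    using spacelike_bform_le[OF spacelike_space_part[of v]] assms(1)
    by (simp add: bform_space_part hform_space_part norm_mult)
  then show False using assms(2) by (simp add: eq power2_eq_square)
qed

lemma orthonormal_i1_i2: "orthonormal2 (evec i1) (evec i2)"
  by (simp add: orthonormal2_def bform_evec)

lemma admissible_i1_i2: "admissible (evec i1) (evec i2) (complex_of_real t)"
  using orthonormal_i1_i2 by (auto simp: admissible_def sig_evec)

lemma pc_qc_rot: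
  "pc (rot (evec i1) (evec i2) (complex_of_real t) v) = cis (- t) * pc v"
  "qc (rot (evec i1) (evec i2) (complex_of_real t) v) = cis t * qc v"
proof -
  let ?w = "rot (evec i1) (evec i2) (complex_of_real t) v"
  have w: "coord ?w i1 = cos t * coord v i1 - sin t * coord v i2"
    "coord ?w i2 = cos t * coord v i2 + sin t * coord v i1"
    using bform_rot_axis[OF orthonormal_i1_i2, of "complex_of_real t" v]
    by (simp_all add: bform_evec_right cos_of_real sin_of_real)
  show "pc ?w = cis (- t) * pc v" "qc ?w = cis t * qc v"
    unfolding pc_def qc_def w by (simp_all add: complex_eq_iff algebra_simps)
qed

lemma reach_negative:
  assumes v: "bform v v = 0" "Re (hform v v) < 0"
  shows "reach (evec i1 + scale (\<i> * complex_of_real (sgn (cmod (pc v) - cmod (qc v)))) (evec i2)) v"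
proof -
  \<comment> \<open>The phase \<open>- \<phi>\<close> and the rotation by \<open>\<theta>\<close>
    together turn \<open>pc v\<close> by \<open>- Arg (pc v)\<close> and \<open>qc v\<close> by
    \<open>- Arg (qc v)\<close>, so both become their moduli.\<close>
  define \<phi> where "\<phi> = (Arg (pc v) + Arg (qc v)) / 2"
  define \<theta> where "\<theta> = (Arg (pc v) - Arg (qc v)) / 2"
  define w where "w = rot (evec i1) (evec i2) (complex_of_real \<theta>) (scale (cis (- \<phi>)) v)"
  have vw: "reach v w"
    unfolding w_def by (intro reach.intros admissible_i1_i2) simp
  have bw: "bform w w = 0"
    by (simp add: w_def bform_rot orthonormal_i1_i2 bform_linear v)
  have "hform w w = hform v v"
    by (simp add: w_def hform_rot admissible_i1_i2 hform_scale)
  then have hw: "Re (hform w w) < 0" using v by simp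
  have polar: "cis (- Arg c) * c = cmod c" for c
  proof -
    have "cis (- Arg c) * (complex_of_real (cmod c) * cis (Arg c)) = cmod c"
      by (simp add: cis_mult mult.left_commute)
    then show ?thesis by (simp flip: rcis_def add: rcis_cmod_Arg)
  qed
  have pc_scale: "pc (scale (cis (- \<phi>)) v) = cis (- \<phi>) * pc v" "qc (scale (cis (- \<phi>)) v) = cis (- \<phi>) * qc v"
    by (simp_all add: pc_def qc_def algebra_simps)
  have "pc w = cis (- Arg (pc v)) * pc v"
    unfolding w_def pc_qc_rot pc_scale by (simp add: \<phi>_def \<theta>_def cis_mult field_simps flip: mult.assoc)
  then have pw: "pc w = cmod (pc v)" by (simp add: polar)
  have "qc w = cis (- Arg (qc v)) * qc v"
    unfolding w_def pc_qc_rot pc_scale by (simp add: \<phi>_def \<theta>_def cis_mult field_simps flip: mult.assoc)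
  then have qw: "qc w = cmod (qc v)" by (simp add: polar)
  define \<alpha> where "\<alpha> = (cmod (pc v) + cmod (qc v)) / 2"
  define \<beta> where "\<beta> = (cmod (pc v) - cmod (qc v)) / 2"
  have w1: "coord w i1 = \<alpha>"
  proof -
    have "coord w i1 = (pc w + qc w) / 2" by (simp add: pc_def qc_def)
    then show ?thesis by (simp add: pw qw \<alpha>_def)
  qed
  have w2: "coord w i2 = \<i> * \<beta>"
  proof -
    have "coord w i2 = \<i> * ((pc w - qc w) / 2)" by (simp add: pc_def qc_def)
    then show ?thesis by (simp add: pw qw \<beta>_def)
  qed
  have ne: "cmod (pc v) \<noteq> cmod (qc v)" using timelike_pc_qc v by simp
  have \<alpha>: "\<alpha> > 0" and \<beta>: "\<beta> \<noteq> 0"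
    using ne norm_ge_zero[of "pc v"] norm_ge_zero[of "qc v"] unfolding \<alpha>_def \<beta>_def
    by (auto intro: less_le_trans simp: less_le add_nonneg_eq_0_iff)
  let ?z = "space_part w"
  define H where "H = Re (hform ?z ?z)"
  have hz: "hform ?z ?z = H" unfolding H_def by (rule hform_self)
  have "cmod (pc v) = \<alpha> + \<beta>" "cmod (qc v) = \<alpha> - \<beta>"
    by (simp_all add: \<alpha>_def \<beta>_def field_simps)
  then have pw': "pc w = complex_of_real (\<alpha> + \<beta>)" and qw': "qc w = complex_of_real (\<alpha> - \<beta>)"
    by (simp_all only: pw qw)
  have bz: "bform ?z ?z = complex_of_real (\<beta>\<^sup>2 - \<alpha>\<^sup>2)"
    unfolding bform_space_part bw pw' qw' by (simp add: power2_eq_square algebra_simps)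
  \<comment> \<open>Negativity of \<open>hform w w\<close> in this form says that the square of the
    imaginary part of \<open>?z\<close> is below that of \<open>\<alpha>\<close>, as the boosts
    require.\<close>
  have H: "H < \<alpha>\<^sup>2 + \<beta>\<^sup>2"
    using hw unfolding H_def hform_space_part pw' qw' norm_of_real
    by (simp add: power2_eq_square field_simps)
  have "reach (evec i1 + scale (\<i> * complex_of_real (sgn \<beta>)) (evec i2))
    (scale \<alpha> (evec i1) + scale (\<i> * \<beta>) (evec i2) + (re_part ?z + scale \<i> (im_part ?z)))"
  proof (rule reach_neg_normal)
    show "spacelike (re_part ?z)" "spacelike (im_part ?z)"
      using spacelike_space_part[of w]
      by (simp_all add: spacelike_def re_part_def im_part_def lookup_add lookup_minus lookup_sig)
    show "bform (re_part ?z) (re_part ?z) = complex_of_real ((\<beta>\<^sup>2 - \<alpha>\<^sup>2 + H) / 2)"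
      "bform (im_part ?z) (im_part ?z) = complex_of_real ((H - (\<beta>\<^sup>2 - \<alpha>\<^sup>2)) / 2)"
      "bform (re_part ?z) (im_part ?z) = 0"
      unfolding bform_re_im_part hz bz by simp_all
  qed (use \<alpha> \<beta> H in \<open>auto simp: sig_re_part sig_im_part field_simps\<close>)
  also have "scale \<alpha> (evec i1) + scale (\<i> * \<beta>) (evec i2) + (re_part ?z + scale \<i> (im_part ?z)) = w"
    using space_part_split[of w] by (simp add: w1 w2 flip: re_im_part)
  also have "sgn \<beta> = sgn (cmod (pc v) - cmod (qc v))"
    by (simp add: \<beta>_def sgn_if)
  finally show ?thesis
    using reach_trans[OF reach_sym[OF vw]] by blast
qed

section \<open>Orbits\<close>

lemma continuous_map_direct_limit:
  assumes "\<And>n. continuous_map (X n) Y f"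
  shows "continuous_map (direct_limit_topology X) Y f"
  unfolding continuous_map_def
proof (intro conjI allI impI)
  show "f \<in> topspace (direct_limit_topology X) \<rightarrow> topspace Y"
    using assms by (fastforce simp: topspace_direct_limit_topology continuous_map_def)
  fix U assume "openin Y U"
  then have "openin (X n) {x \<in> topspace (X n). f x \<in> U}" for n
    using assms by (simp add: continuous_map_def)
  moreover have "{x \<in> (\<Union>n. topspace (X n)). f x \<in> U} \<inter> topspace (X n) = {x \<in> topspace (X n). f x \<in> U}" for n
    by auto
  ultimately show "openin (direct_limit_topology X) {x \<in> topspace (direct_limit_topology X). f x \<in> U}"
    by (auto simp: openin_direct_limit_topology topspace_direct_limit_topology)
qed

text \<open>On every stage this is a fixed finite linear combination of matrix entries.\<close>

lemma continuous_map_orbit_coord: "continuous_map SO_inf_top euclidean (\<lambda>g. coord (g v) i)"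
  unfolding SO_inf_top_def
proof (rule continuous_map_direct_limit)
  fix n
  let ?\<Phi> = "\<lambda>g i j. coord (g (evec j)) i"
  let ?F = "\<lambda>M :: idx \<Rightarrow> idx \<Rightarrow> complex. \<Sum>j\<in>Poly_Mapping.keys v. coord v j * M i j"
  have "continuous_on UNIV (\<lambda>M :: idx \<Rightarrow> idx \<Rightarrow> complex. M i j)" for j
    using continuous_on_compose2[OF continuous_on_product_coordinates[of j] continuous_on_product_coordinates[of i]]
    by simp
  then have "continuous_map euclidean euclidean ?F"
    by (simp add: continuous_on_sum continuous_on_mult_left)
  then have "continuous_map (SO_n_top n) euclidean (?F \<circ> ?\<Phi>)"
    unfolding SO_n_top_def by (rule continuous_map_pullback)
  then show "continuous_map (SO_n_top n) euclidean (\<lambda>g. coord (g v) i)"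
  proof (rule continuous_map_eq)
    fix g assume "g \<in> topspace (SO_n_top n)"
    then have "Vector_Spaces.linear scale scale g"
      by (simp add: topspace_SO_n_top SO_n_def SO_inf_def)
    then show "(?F \<circ> ?\<Phi>) g = coord (g v) i"
      by (simp add: lookup_linear[of g "Poly_Mapping.keys v"])
  qed
qed

lemma continuous_map_mult_left:
  fixes f :: "'a \<Rightarrow> complex"
  assumes "continuous_map X euclidean f"
  shows "continuous_map X euclidean (\<lambda>x. c * f x)"
  using continuous_map_compose[OF assms, of euclidean "(*) c"]
  by (simp add: o_def continuous_on_mult_left)

text \<open>Positive at \<open>evec i1 + scale \<i> (evec i2)\<close>, where \<open>qc\<close>
  vanishes, and negative at the conjugate vector, where \<open>pc\<close> vanishes.\<close>

definition orientation :: "V \<Rightarrow> real"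
  where "orientation v = cmod (pc v) - cmod (qc v)"

lemma continuous_map_orientation: "continuous_map SO_inf_top euclideanreal (\<lambda>g. orientation (g v))"
  unfolding orientation_def pc_def qc_def
  by (intro continuous_intros continuous_map_mult_left continuous_map_orbit_coord)

lemma G0_bform: "g \<in> carrier G0 \<Longrightarrow> bform (g x) (g y) = bform x y"
  and G0_hform: "g \<in> carrier G0 \<Longrightarrow> hform (g x) (g y) = hform x y"
  and G0_linear: "g \<in> carrier G0 \<Longrightarrow> Vector_Spaces.linear scale scale g"
  using G0_subset by (auto simp: SO_inf_h_def SO_inf_def)

lemma orientation_nonzero: "bform v v = 0 \<Longrightarrow> Re (hform v v) < 0 \<Longrightarrow> orientation v \<noteq> 0"
  using timelike_pc_qc by (simp add: orientation_def)

text \<open>The values along the connected set \<open>carrier G0\<close> form a connected set of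
  reals that avoids 0.\<close>

lemma G0_orientation:
  assumes g: "g \<in> carrier G0" and v: "bform v v = 0" "Re (hform v v) < 0"
  shows "sgn (orientation (g v)) = sgn (orientation v)"
proof -
  let ?X = "subtopology SO_inf_top SO_inf_h" and ?F = "\<lambda>g. orientation (g v)"
  have "connectedin ?X (carrier G0)"
    by (simp add: G0_def connectedin_connected_component_of)
  moreover have "continuous_map ?X euclideanreal ?F"
    by (rule continuous_map_from_subtopology[OF continuous_map_orientation])
  ultimately have "connected (?F ` carrier G0)"
    using connectedin_continuous_map_image by fastforce
  moreover have "0 \<notin> ?F ` carrier G0"
  proof
    assume "0 \<in> ?F ` carrier G0"
    then obtain k where k: "k \<in> carrier G0" "orientation (k v) = 0" by auto
    then show False
      using orientation_nonzero[of "k v"] v by (simp add: G0_bform G0_hform)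
  qed
  moreover have "?F g \<in> ?F ` carrier G0" "?F id \<in> ?F ` carrier G0"
    using g id_in_G0 by blast+
  ultimately have "\<not> (?F g \<le> 0 \<and> 0 \<le> ?F id)" "\<not> (?F id \<le> 0 \<and> 0 \<le> ?F g)"
    by (meson connectedD_interval)+
  then show ?thesis by (auto simp: sgn_if)
qed

lemma pt_eqD:
  assumes "pt v = pt w" "v \<noteq> 0"
  shows "\<exists>c. c \<noteq> 0 \<and> v = scale c w"
proof -
  have "v \<in> pt w" using assms(1) by (metis pt_def V.span_base singletonI)
  then obtain c where "v = scale c w" by (auto simp: pt_def V.span_singleton)
  then show ?thesis using assms(2) by (intro exI[of _ c]) auto
qed

lemma orientation_scale: "orientation (scale c v) = cmod c * orientation v"
proof -
  have "pc (scale c v) = c * pc v" "qc (scale c v) = c * qc v"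
    by (simp_all add: pc_def qc_def algebra_simps)
  then show ?thesis by (simp add: orientation_def norm_mult algebra_simps)
qed

lemma Re_hform_scale: "Re (hform (scale c v) (scale c v)) = (cmod c)\<^sup>2 * Re (hform v v)"
  by (simp add: hform_scale flip: of_real_power)

section \<open>Orbits as sets of isotropic points\<close>

definition isotropic_points :: "(V \<Rightarrow> bool) \<Rightarrow> V set set"
  where "isotropic_points P = {pt v | v. v \<noteq> 0 \<and> bform v v = 0 \<and> P v}"

text \<open>Such a predicate on vectors descends to lines.\<close>

definition scale_invariant :: "(V \<Rightarrow> bool) \<Rightarrow> bool"
  where "scale_invariant P \<longleftrightarrow> (\<forall>c v. c \<noteq> 0 \<longrightarrow> P (scale c v) = P v)"

definition neg_plus :: "V \<Rightarrow> bool"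
  where "neg_plus v \<longleftrightarrow> Re (hform v v) < 0 \<and> orientation v > 0"
definition neg_minus :: "V \<Rightarrow> bool"
  where "neg_minus v \<longleftrightarrow> Re (hform v v) < 0 \<and> orientation v < 0"
definition pos :: "V \<Rightarrow> bool"
  where "pos v \<longleftrightarrow> Re (hform v v) > 0"

lemma scale_invariant: "scale_invariant neg_plus" "scale_invariant neg_minus" "scale_invariant pos"
  by (auto simp: scale_invariant_def neg_plus_def neg_minus_def pos_def Re_hform_scale
      orientation_scale zero_less_mult_iff mult_less_0_iff)

lemma pt_in_isotropic_points_iff:
  assumes "scale_invariant P" "v \<noteq> 0"
  shows "pt v \<in> isotropic_points P \<longleftrightarrow> bform v v = 0 \<and> P v"
proof
  assume "pt v \<in> isotropic_points P"
  then obtain w where w: "pt v = pt w" "bform w w = 0" "P w" by (auto simp: isotropic_points_def)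
  then obtain c where "c \<noteq> 0" "v = scale c w" using pt_eqD assms(2) by blast
  then show "bform v v = 0 \<and> P v"
    using w assms(1) by (simp add: scale_invariant_def bform_linear)
qed (use assms(2) in \<open>auto simp: isotropic_points_def\<close>)

text \<open>Nondegeneracy of \<open>bform\<close>: pairing with the images of basis vectors recovers
  the coordinates of \<open>v\<close>.\<close>

lemma G0_nonzero:
  assumes "g \<in> carrier G0" "v \<noteq> 0" shows "g v \<noteq> 0"
proof
  assume g: "g v = 0"
  have "coord v i = 0" for i
  proof -
    have "bform (g v) (g (evec i)) = 0" by (simp add: g bform_def)
    then show ?thesis by (simp add: G0_bform[OF assms(1)] bform_evec_right)
  qed
  then have "v = 0" by (intro poly_mapping_eqI) simp
  then show False using assms(2) by simp
qed

lemma orbit_pt: "orbit G0 act (pt v) = {pt (g v) | g. g \<in> carrier G0}"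
  using act_pt[OF G0_linear] by (fastforce simp: orbit_def)

text \<open>Invariance bounds the orbit from above, and reachability fills the set.\<close>

lemma orbit_eq_isotropic_points:
  assumes trans: "\<And>w. bform w w = 0 \<Longrightarrow> P w \<Longrightarrow> reach v w"
    and inv: "\<And>g. g \<in> carrier G0 \<Longrightarrow> P (g v)"
    and v: "v \<noteq> 0" "bform v v = 0"
  shows "orbit G0 act (pt v) = isotropic_points P"
proof (rule antisym)
  show "orbit G0 act (pt v) \<subseteq> isotropic_points P"
  proof
    fix L assume "L \<in> orbit G0 act (pt v)"
    then obtain g where g: "g \<in> carrier G0" "L = pt (g v)" by (auto simp: orbit_pt)
    then have "g v \<noteq> 0" "bform (g v) (g v) = 0" "P (g v)"
      using inv v by (simp_all add: G0_nonzero G0_bform)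
    then show "L \<in> isotropic_points P" unfolding isotropic_points_def g(2) by blast
  qed
  show "isotropic_points P \<subseteq> orbit G0 act (pt v)"
  proof
    fix L assume "L \<in> isotropic_points P"
    then obtain w where w: "L = pt w" "reach v w" using trans by (auto simp: isotropic_points_def)
    then obtain g where "g \<in> carrier G0" "pt (g v) = pt w" using reach_G0 by blast
    then show "L \<in> orbit G0 act (pt v)" unfolding orbit_pt w(1) by (metis (mono_tags, lifting) mem_Collect_eq)
  qed
qed

lemma fresh_pair:
  assumes "finite S"
  obtains a b where "Rep_idx a < 0" "Rep_idx b < 0" "a \<noteq> b" "a \<notin> S" "b \<notin> S"
proof -
  obtain n where n: "\<And>i. i \<in> S \<Longrightarrow> - int n \<le> Rep_idx i"
    using finite_idx_bound[OF assms] by blast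
  let ?a = "Abs_idx (- int n - 1)" and ?b = "Abs_idx (- int n - 2)"
  have r: "Rep_idx ?a = - int n - 1" "Rep_idx ?b = - int n - 2"
    by (simp_all add: Rep_idx_neg)
  show ?thesis
  proof (rule that)
    show "?a \<noteq> ?b" using r by force
    show "?a \<notin> S" "?b \<notin> S" using n r by force+
  qed (simp_all add: r)
qed

text \<open>Indices outside both supports give a normal form common to the two vectors.\<close>

lemma reach_pos:
  assumes "bform v v = 0" "pos v" "bform w w = 0" "pos w"
  shows "reach v w"
proof -
  obtain a b where "Rep_idx a < 0" "Rep_idx b < 0" "a \<noteq> b"
    "a \<notin> Poly_Mapping.keys v \<union> Poly_Mapping.keys w" "b \<notin> Poly_Mapping.keys v \<union> Poly_Mapping.keys w"
    using fresh_pair[of "Poly_Mapping.keys v \<union> Poly_Mapping.keys w"] by auto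
  then have "reach v (evec a + scale \<i> (evec b))" "reach w (evec a + scale \<i> (evec b))"
    using assms by (auto simp: pos_def in_keys_iff intro!: reach_positive)
  then show ?thesis by (rule reach_trans[OF reach_sym, rotated])
qed

text \<open>The normal form of a negative vector depends only on the sign of its
  orientation.\<close>

lemma reach_neg:
  assumes "bform v v = 0" "Re (hform v v) < 0" "bform w w = 0" "Re (hform w w) < 0"
    and "sgn (orientation v) = sgn (orientation w)"
  shows "reach v w"
proof -
  define x where "x = evec i1 + scale (\<i> * complex_of_real (sgn (orientation v))) (evec i2)"
  have "reach x v" "reach x w"
    using reach_negative[of v] reach_negative[of w] assms by (simp_all add: x_def orientation_def)
  then show ?thesis by (rule reach_trans[OF _ reach_sym, rotated])
qed

lemma orbit_neg_plus:
  assumes "v \<noteq> 0" "bform v v = 0" "neg_plus v"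
  shows "orbit G0 act (pt v) = isotropic_points neg_plus"
proof (rule orbit_eq_isotropic_points)
  fix g assume "g \<in> carrier G0"
  then show "neg_plus (g v)"
    using assms G0_orientation[of g v] by (simp add: neg_plus_def G0_hform sgn_if split: if_splits)
qed (use assms in \<open>auto simp: neg_plus_def intro: reach_neg\<close>)

lemma orbit_neg_minus:
  assumes "v \<noteq> 0" "bform v v = 0" "neg_minus v"
  shows "orbit G0 act (pt v) = isotropic_points neg_minus"
proof (rule orbit_eq_isotropic_points)
  fix g assume "g \<in> carrier G0"
  then show "neg_minus (g v)"
    using assms G0_orientation[of g v] by (simp add: neg_minus_def G0_hform sgn_if split: if_splits)
qed (use assms in \<open>auto simp: neg_minus_def intro: reach_neg\<close>)

lemma orbit_pos:
  assumes "v \<noteq> 0" "bform v v = 0" "pos v"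
  shows "orbit G0 act (pt v) = isotropic_points pos"
  using assms by (intro orbit_eq_isotropic_points reach_pos) (auto simp: pos_def G0_hform)

section \<open>Open and non-open orbits\<close>

lemma finite_idx_ge: "finite {i. - int n \<le> Rep_idx i}"
proof (rule finite_imageD)
  show "finite (Rep_idx ` {i. - int n \<le> Rep_idx i})"
  proof (rule finite_subset)
    have "Rep_idx i \<le> 2" for i using Rep_idx[of i] by auto
    then show "Rep_idx ` {i. - int n \<le> Rep_idx i} \<subseteq> {- int n..2}" by auto
  qed simp
  show "inj_on Rep_idx {i. - int n \<le> Rep_idx i}"
    by (simp add: inj_on_def Rep_idx_inject)
qed

lemma V_n_iff: "v \<in> V_n n \<longleftrightarrow> Poly_Mapping.keys v \<subseteq> {i. - int n \<le> Rep_idx i}"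
proof
  let ?B = "{i. - int n \<le> Rep_idx i}"
  have "V.subspace {v. Poly_Mapping.keys v \<subseteq> ?B}"
    using keys_add keys_scale by (intro V.subspaceI) fastforce+
  moreover have "evec ` ?B \<subseteq> {v. Poly_Mapping.keys v \<subseteq> ?B}"
    by (auto simp: evec_def)
  ultimately have "V_n n \<subseteq> {v. Poly_Mapping.keys v \<subseteq> ?B}"
    unfolding V_n_def by (rule V.span_minimal[rotated])
  then show "v \<in> V_n n \<Longrightarrow> Poly_Mapping.keys v \<subseteq> ?B" by auto
  assume "Poly_Mapping.keys v \<subseteq> ?B"
  then have "(\<Sum>i\<in>Poly_Mapping.keys v. scale (coord v i) (evec i)) \<in> V_n n"
    unfolding V_n_def by (intro V.span_sum V.span_scale V.span_base) auto
  then show "v \<in> V_n n"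
    using keys_expand[of "Poly_Mapping.keys v" v] by simp
qed

lemma topspace_V_n_top: "topspace (V_n_top n) = V_n n"
  by (simp add: V_n_top_def topspace_pullback_topology)

lemma topspace_P_n_top: "topspace (P_n_top n) = pt ` (V_n n - {0})"
  by (simp add: P_n_top_def topspace_quotient_topology topspace_V_n_top Diff_eq)

lemma continuous_map_coord: "continuous_map (V_n_top n) euclidean (\<lambda>v. coord v i)"
proof -
  have "continuous_map euclidean euclidean (\<lambda>x :: idx \<Rightarrow> complex. x i)"
    by simp
  then have "continuous_map (V_n_top n) euclidean ((\<lambda>x :: idx \<Rightarrow> complex. x i) \<circ> Poly_Mapping.lookup)"
    unfolding V_n_top_def by (rule continuous_map_pullback)
  then show ?thesis by (simp add: o_def)
qed

lemma continuous_map_orientation_V: "continuous_map (V_n_top n) euclideanreal orientation"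
  unfolding orientation_def pc_def qc_def by (intro continuous_intros continuous_map_mult_left continuous_map_coord)

text \<open>The support varies with \<open>v\<close>, so the sum is extended to the fixed finite
  index set of \<open>V_n n\<close>.\<close>

lemma continuous_map_hform: "continuous_map (V_n_top n) euclideanreal (\<lambda>v. Re (hform v v))"
proof -
  let ?B = "{i. - int n \<le> Rep_idx i}"
  have "continuous_map (V_n_top n) euclideanreal
      (\<lambda>v. \<Sum>i\<in>?B. (if Rep_idx i < 0 then 1 else - 1) * (cmod (coord v i))\<^sup>2)"
    using finite_idx_ge by (intro continuous_intros continuous_map_mult_left continuous_map_coord) auto
  then show ?thesis
  proof (rule continuous_map_eq)
    fix v assume "v \<in> topspace (V_n_top n)"
    then have "Poly_Mapping.keys v \<subseteq> ?B" by (simp add: topspace_V_n_top V_n_iff)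
    then have "(\<Sum>i\<in>Poly_Mapping.keys v. (if Rep_idx i < 0 then 1 else - 1) * (cmod (coord v i))\<^sup>2) =
        (\<Sum>i\<in>?B. (if Rep_idx i < 0 then 1 else - 1) * (cmod (coord v i))\<^sup>2)"
      using finite_idx_ge by (intro sum.mono_neutral_left) (auto simp: in_keys_iff)
    then show "(\<Sum>i\<in>?B. (if Rep_idx i < 0 then 1 else - 1) * (cmod (coord v i))\<^sup>2) = Re (hform v v)"
      by (simp add: hform_sum)
  qed
qed

lemma openin_continuous_pos:
  assumes "continuous_map X euclideanreal f"
  shows "openin X {x \<in> topspace X. 0 < f x}" "openin X {x \<in> topspace X. f x < 0}"
  using openin_continuous_map_preimage[OF assms, of "{0<..}"]
    openin_continuous_map_preimage[OF assms, of "{..<0}"] by auto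

text \<open>Openness is checked on each stage, and there on the punctured space
  \<open>V_n n - {0}\<close> through the quotient map.\<close>

lemma openin_isotropic_points:
  assumes inv: "scale_invariant P" and op: "\<And>n. openin (V_n_top n) {v \<in> V_n n. P v}"
  shows "openin Z_top (isotropic_points P)"
proof -
  have "openin (subtopology (P_n_top n) Z) (isotropic_points P \<inter> topspace (subtopology (P_n_top n) Z))" for n
  proof -
    let ?T = "pt ` {v \<in> V_n n - {0}. P v}"
    \<comment> \<open>Scale invariance makes the set of vectors saturated for the quotient
      map.\<close>
    have pre: "{x \<in> V_n n \<inter> - {0}. pt x \<in> ?T} = {v \<in> V_n n. P v} \<inter> - {0}"
    proof (intro subset_antisym subsetI)
      fix x assume x: "x \<in> {x \<in> V_n n \<inter> - {0}. pt x \<in> ?T}"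
      then obtain v where "pt x = pt v" "P v" by auto
      then obtain c where "c \<noteq> 0" "x = scale c v" using x pt_eqD by blast
      then show "x \<in> {v \<in> V_n n. P v} \<inter> - {0}"
        using inv x \<open>P v\<close> by (auto simp: scale_invariant_def)
    qed auto
    have "openin (P_n_top n) ?T"
      unfolding P_n_top_def openin_quotient_topology topspace_subtopology topspace_V_n_top pre
      using op by (auto intro: openin_subtopology_Int)
    moreover have "isotropic_points P \<inter> (pt ` (V_n n - {0}) \<inter> Z) = ?T \<inter> Z"
    proof (intro subset_antisym subsetI)
      fix L assume "L \<in> isotropic_points P \<inter> (pt ` (V_n n - {0}) \<inter> Z)"
      then show "L \<in> ?T \<inter> Z" using pt_in_isotropic_points_iff[OF inv] by auto
    next
      fix L assume L: "L \<in> ?T \<inter> Z"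
      then obtain v where v: "L = pt v" "v \<in> V_n n" "v \<noteq> 0" "P v" by auto
      obtain w where w: "pt v = pt w" "w \<noteq> 0" "bform w w = 0"
        using L v by (auto simp: Z_def)
      obtain c where "v = scale c w" using pt_eqD v w by blast
      then have "bform v v = 0" using w by (simp add: bform_linear)
      then show "L \<in> isotropic_points P \<inter> (pt ` (V_n n - {0}) \<inter> Z)"
        using L v pt_in_isotropic_points_iff[OF inv] by auto
    qed
    ultimately show ?thesis
      by (auto simp: openin_subtopology topspace_P_n_top)
  qed
  moreover have "isotropic_points P \<subseteq> (\<Union>n. topspace (subtopology (P_n_top n) Z))"
    using topspace_Z_top unfolding Z_top_def topspace_direct_limit_topology
    by (auto simp: isotropic_points_def Z_def)
  ultimately show ?thesis
    unfolding Z_top_def openin_direct_limit_topology by blast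
qed

lemma openin_parts: "openin Z_top (isotropic_points neg_plus)" "openin Z_top (isotropic_points neg_minus)" "openin Z_top (isotropic_points pos)"
proof -
  note op = openin_continuous_pos[OF continuous_map_hform, unfolded topspace_V_n_top]
    openin_continuous_pos[OF continuous_map_orientation_V, unfolded topspace_V_n_top]
  have "{v \<in> V_n n. neg_plus v} = {v \<in> V_n n. Re (hform v v) < 0} \<inter> {v \<in> V_n n. 0 < orientation v}"
    "{v \<in> V_n n. neg_minus v} = {v \<in> V_n n. Re (hform v v) < 0} \<inter> {v \<in> V_n n. orientation v < 0}" for n
    by (auto simp: neg_plus_def neg_minus_def)
  then show "openin Z_top (isotropic_points neg_plus)" "openin Z_top (isotropic_points neg_minus)"
    using op by (auto intro!: openin_isotropic_points scale_invariant openin_Int)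
  show "openin Z_top (isotropic_points pos)"
    using op by (auto intro!: openin_isotropic_points scale_invariant simp: pos_def)
qed

text \<open>The vector \<open>v\<close> is perturbed along \<open>e\<^sub>a + \<i>e\<^sub>b\<close> with \<open>a\<close>, \<open>b\<close> outside the support of \<open>v\<close>: the result stays
  isotropic, but \<^term>\<open>hform\<close> becomes positive.\<close>

lemma null_orbit_not_open:
  assumes v: "v \<noteq> 0" "bform v v = 0" "Re (hform v v) = 0"
  shows "\<not> openin Z_top (orbit G0 act (pt v))"
proof
  let ?D = "orbit G0 act (pt v)"
  assume D: "openin Z_top ?D"
  obtain a b where ab: "Rep_idx a < 0" "Rep_idx b < 0" "a \<noteq> b" "coord v a = 0" "coord v b = 0"
    using fresh_pair[of "Poly_Mapping.keys v"] by (auto simp: in_keys_iff)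
  define u where "u = evec a + scale \<i> (evec b)"
  define \<gamma> where "\<gamma> t = v + scale (complex_of_real t) u" for t
  have bu: "bform (\<gamma> t) (\<gamma> t) = 0" for t
    using ab v by (simp add: \<gamma>_def u_def lookup_add bform_linear bform_evec bform_evec_left bform_evec_right coord_evec algebra_simps)
  \<comment> \<open>The cross terms vanish because \<open>a\<close> and \<open>b\<close> do not
    occur in \<open>v\<close>, and \<open>hform u u = 2\<close>.\<close>
  have hu: "Re (hform (\<gamma> t) (\<gamma> t)) = 2 * t\<^sup>2" for t
  proof -
    have "hform (\<gamma> t) (\<gamma> t) = hform v v + 2 * t\<^sup>2"
      using ab by (simp add: \<gamma>_def u_def lookup_add hform_eq_bform_sig sig_add sig_scale sig_evec bform_linear
          bform_evec bform_evec_left bform_evec_right coord_evec lookup_sig power2_eq_square algebra_simps)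
    then show ?thesis using v by simp
  qed
  obtain n where n: "\<And>i. i \<in> Poly_Mapping.keys v \<union> {a, b} \<Longrightarrow> - int n \<le> Rep_idx i"
    using finite_idx_bound[of "Poly_Mapping.keys v \<union> {a, b}"] by auto
  have \<gamma>V: "\<gamma> t \<in> V_n n" for t
  proof -
    have "Poly_Mapping.keys (\<gamma> t) \<subseteq> Poly_Mapping.keys v \<union> {a, b}"
      by (auto simp: in_keys_iff \<gamma>_def u_def lookup_add coord_evec split: if_splits)
    then show ?thesis using n by (auto simp: V_n_iff)
  qed
  obtain T where T: "openin (P_n_top n) T" "?D \<inter> topspace (subtopology (P_n_top n) Z) = T \<inter> Z"
    using D unfolding Z_top_def openin_direct_limit_topology openin_subtopology by blast
  have "openin (subtopology (V_n_top n) (- {0})) {x \<in> V_n n \<inter> - {0}. pt x \<in> T}"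
    using T(1) by (simp add: P_n_top_def openin_quotient_topology topspace_V_n_top)
  then obtain U where U: "open U" "{x \<in> V_n n \<inter> - {0}. pt x \<in> T} = (Poly_Mapping.lookup -` U \<inter> V_n n) \<inter> - {0}"
    by (auto simp: openin_subtopology V_n_top_def openin_pullback_topology)
  have "pt v \<in> ?D"
    unfolding orbit_pt mem_Collect_eq by (intro exI[of _ id] conjI id_in_G0) simp
  moreover have "v \<in> V_n n" using n by (auto simp: V_n_iff)
  ultimately have "pt v \<in> T"
    using T(2) v by (auto simp: topspace_P_n_top Z_def)
  then have "coord v \<in> U"
    using U(2) v(1) \<open>v \<in> V_n n\<close> by blast
  then have 0: "coord (\<gamma> 0) \<in> U" by (simp add: \<gamma>_def)
  \<comment> \<open>Since \<open>\<gamma> 0 = v\<close> has its coordinates in \<open>U\<close>,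
    continuity keeps the path in \<open>U\<close> for small positive \<open>t\<close>.\<close>
  have "continuous_on UNIV (\<lambda>t. coord (\<gamma> t))"
    by (intro continuous_on_coordinatewise_then_product) (simp add: \<gamma>_def lookup_add continuous_intros)
  then have "open ((\<lambda>t. coord (\<gamma> t)) -` U)"
    using U(1) by (rule open_vimage[rotated])
  then obtain e where e: "e > 0" "ball 0 e \<subseteq> (\<lambda>t. coord (\<gamma> t)) -` U"
    using 0 openE by blast
  define t where "t = e / 2"
  have t: "t > 0" "coord (\<gamma> t) \<in> U" using e by (auto simp: t_def dist_norm subset_iff)
  have "\<gamma> t \<noteq> 0" using hu[of t] t by (auto simp: hform_def)
  then have "pt (\<gamma> t) \<in> T" using U(2) t(2) \<gamma>V by blast
  moreover have "pt (\<gamma> t) \<in> Z" using \<open>\<gamma> t \<noteq> 0\<close> bu by (auto simp: Z_def)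
  ultimately have "pt (\<gamma> t) \<in> ?D" using T(2) by blast
  then obtain g where g: "g \<in> carrier G0" "pt (\<gamma> t) = pt (g v)" by (auto simp: orbit_pt)
  then obtain c where "\<gamma> t = scale c (g v)" using pt_eqD \<open>\<gamma> t \<noteq> 0\<close> by blast
  \<comment> \<open>Every line in the orbit of a null line is null, against the positive value found
    above.\<close>
  then have "Re (hform (\<gamma> t) (\<gamma> t)) = 0"
    using v(3) g(1) by (simp add: Re_hform_scale G0_hform)
  then show False using hu[of t] t by simp
qed

lemma parts_negative_definite: "h_negative_definite (isotropic_points neg_plus)" "h_negative_definite (isotropic_points neg_minus)"
  and part_positive_definite: "h_positive_definite (isotropic_points pos)"
proof -
  have *: "Re (hform w w) < 0" if "w \<in> pt v" "w \<noteq> 0" "Re (hform v v) < 0" for v w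
    using that by (auto simp: pt_def V.span_singleton Re_hform_scale mult_less_0_iff)
  then show "h_negative_definite (isotropic_points neg_plus)" "h_negative_definite (isotropic_points neg_minus)"
    by (auto simp: h_negative_definite_def isotropic_points_def neg_plus_def neg_minus_def)
  have "Re (hform w w) > 0" if "w \<in> pt v" "w \<noteq> 0" "Re (hform v v) > 0" for v w
    using that by (auto simp: pt_def V.span_singleton Re_hform_scale)
  then show "h_positive_definite (isotropic_points pos)"
    by (auto simp: h_positive_definite_def isotropic_points_def pos_def)
qed

theorem lemma4p4p5:
  shows "{D \<in> orbits G0 Z act. openin Z_top D} = {D0, D1, D2} \<and>
    card {D0, D1, D2} = 3 \<and>
    h_negative_definite D0 \<and> h_negative_definite D1 \<and> h_positive_definite D2"
proof -
  define v0 where "v0 = evec i1 + scale \<i> (evec i2)"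
  define v1 where "v1 = evec i1 - scale \<i> (evec i2)"
  define v2 where "v2 = evec (Abs_idx (-1)) + scale \<i> (evec (Abs_idx (-2)))"
  note forms = bform_linear bform_evec bform_evec_left coord_evec hform_eq_bform_sig sig_add sig_diff
    sig_scale sig_evec Rep_idx_neg lookup_add lookup_minus orientation_def pc_def qc_def
  have ne: "Abs_idx (-1) \<noteq> Abs_idx (-2)" "Abs_idx (-2) \<noteq> Abs_idx (-1)"
    by (simp_all add: Rep_idx_neg flip: Rep_idx_inject)
  have v0: "bform v0 v0 = 0" "neg_plus v0" by (simp_all add: v0_def neg_plus_def forms)
  have v1: "bform v1 v1 = 0" "neg_minus v1" by (simp_all add: v1_def neg_minus_def forms)
  have v2: "bform v2 v2 = 0" "pos v2" using ne by (simp_all add: v2_def pos_def forms)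
  have nz: "v0 \<noteq> 0" "v1 \<noteq> 0" "v2 \<noteq> 0"
    using v0(2) v1(2) v2(2) by (auto simp: neg_plus_def neg_minus_def pos_def hform_def)
  have D0: "D0 = isotropic_points neg_plus" using orbit_neg_plus[OF nz(1) v0] by (simp add: D0_def v0_def)
  have D1: "D1 = isotropic_points neg_minus" using orbit_neg_minus[OF nz(2) v1] by (simp add: D1_def v1_def)
  have D2: "D2 = isotropic_points pos" using orbit_pos[OF nz(3) v2] by (simp add: D2_def v2_def)
  \<comment> \<open>These memberships make the three orbits pairwise distinct.\<close>
  have "pt v0 \<in> D0" "pt v1 \<in> D1" "pt v0 \<notin> D1" "pt v0 \<notin> D2" "pt v1 \<notin> D2"
    using v0 v1 nz by (simp_all add: D0 D1 D2 pt_in_isotropic_points_iff[OF scale_invariant(1)]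
        pt_in_isotropic_points_iff[OF scale_invariant(2)] pt_in_isotropic_points_iff[OF scale_invariant(3)]
        neg_plus_def neg_minus_def pos_def)
  then have "card {D0, D1, D2} = 3" by (auto simp: card_insert_if)
  moreover have "D \<in> {D0, D1, D2}" if D: "D \<in> orbits G0 Z act" "openin Z_top D" for D
  proof -
    obtain v where v: "v \<noteq> 0" "bform v v = 0" and Dv: "D = orbit G0 act (pt v)"
      using D(1) by (auto simp: orbits_def Z_def)
    \<comment> \<open>An open orbit is not null, and the signs of \<open>hform\<close> and
      \<open>orientation\<close> then leave exactly the three listed cases.\<close>
    have "Re (hform v v) \<noteq> 0" using null_orbit_not_open v D(2) Dv by blast
    then consider "neg_plus v" | "neg_minus v" | "pos v"
      using orientation_nonzero[of v] v
      by (auto simp: neg_plus_def neg_minus_def pos_def linorder_neq_iff)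
    then show ?thesis
      using v by cases (auto simp: Dv D0 D1 D2 orbit_neg_plus orbit_neg_minus orbit_pos)
  qed
  moreover have "pt v0 \<in> Z" "pt v1 \<in> Z" "pt v2 \<in> Z"
    using v0 v1 v2 nz by (auto simp: Z_def)
  then have "{D0, D1, D2} \<subseteq> orbits G0 Z act"
    unfolding orbits_def D0_def D1_def D2_def v0_def v1_def v2_def by blast
  moreover have "openin Z_top D0" "openin Z_top D1" "openin Z_top D2"
    using openin_parts by (simp_all add: D0 D1 D2)
  ultimately show ?thesis
    using parts_negative_definite part_positive_definite by (auto simp: D0 D1 D2)
qed

end
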